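(* Let $G$ be one of $\mathrm{GL}(V)$ or $\mathrm{PGL}(V)$, where $V=\mathbb{F}_q^n$. For $m\in\mathbb{N}$ let $$c(m):=\#\{H\leq G \mid H\in\mathfrak{X}(G),\ |G:H|=m\},$$ where $\mathfrak{X}(G)$ is the set of closed subgroups $H$ in $G$ such that the lattice $\mathcal{S}(V,H)$ of $H$-invariant subspaces of $V$ is isomorphic to a direct product $\prod_i C_i$ of finite chains. Then there exists an absolute constant $\alpha$, independent of $n$ and $q$, such that $c(m)\leq m^{\alpha}$ for every $m\in\mathbb{N}$.
   Context: $\mathbb{F}_q$ is the finite field with $q$ elements and $V=\mathbb{F}_q^n$. $G=\mathrm{GL}(V)$ acts naturally on the lattice of subspaces of $V$, and $G=\mathrm{PGL}(V)=\mathrm{GL}(V)/Z(\mathrm{GL}(V))$ acts on it by the induced action; $W^g$ denotes the image of $W$ under $g$. For $H\leq G$, $\mathcal{S}(V,H)$ is the set of all $H$-invariant subspaces of $V$ (those $W\leq V$ with $W^h=W$ for all $h\in H$, including $0$ and $V$), a lattice under inclusion. $H$ is closed in $G$ if $H=\{g\in G : W^g=W \text{ for every } W\in\mathcal{S}(V,H)\}$. A chain is a totally ordered set. The direct product of lattices carries the componentwise order; two lattices are isomorphic if there is an order-preserving bijection between them whose inverse is order-preserving. $\mathbb{N}$ denotes the positive integers. *)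

theory Defs
  imports "HOL-Algebra.Algebra"
begin

definition coord_space :: "('a, 'r) ring_scheme \<Rightarrow> nat \<Rightarrow> ('a, nat \<Rightarrow> 'a) module" where
  "coord_space F n =
    \<lparr>carrier = {..<n} \<rightarrow>\<^sub>E carrier F,
     monoid.mult = undefined, monoid.one = undefined, \<comment> \<open>fields of the record that a vector space does not use\<close>
     ring.zero = (\<lambda>i\<in>{..<n}. \<zero>\<^bsub>F\<^esub>),
     ring.add = (\<lambda>u v. \<lambda>i\<in>{..<n}. u i \<oplus>\<^bsub>F\<^esub> v i),
     smult = (\<lambda>a v. \<lambda>i\<in>{..<n}. a \<otimes>\<^bsub>F\<^esub> v i)\<rparr>"

definition linear_maps ::
    "('a, 'r) ring_scheme \<Rightarrow> ('a, 'v, 's) module_scheme \<Rightarrow> ('v \<Rightarrow> 'v) set" where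
  "linear_maps F V =
    {g \<in> carrier V \<rightarrow> carrier V.
       (\<forall>u\<in>carrier V. \<forall>v\<in>carrier V. g (u \<oplus>\<^bsub>V\<^esub> v) = g u \<oplus>\<^bsub>V\<^esub> g v) \<and>
       (\<forall>a\<in>carrier F. \<forall>v\<in>carrier V. g (a \<odot>\<^bsub>V\<^esub> v) = a \<odot>\<^bsub>V\<^esub> g v)}"

definition GL :: "('a, 'r) ring_scheme \<Rightarrow> ('a, 'v, 's) module_scheme \<Rightarrow> ('v \<Rightarrow> 'v) monoid" where
  "GL F V = BijGroup (carrier V) \<lparr>carrier := linear_maps F V \<inter> Bij (carrier V)\<rparr>"

definition center :: "('g, 'm) monoid_scheme \<Rightarrow> 'g set" where
  "center G = {z \<in> carrier G. \<forall>g\<in>carrier G. z \<otimes>\<^bsub>G\<^esub> g = g \<otimes>\<^bsub>G\<^esub> z}"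

definition PGL :: "('a, 'r) ring_scheme \<Rightarrow> ('a, 'v, 's) module_scheme \<Rightarrow> ('v \<Rightarrow> 'v) set monoid" where
  "PGL F V = GL F V Mod center (GL F V)"

text \<open>The actions on subspaces. The members of a coset of the center are nonzero scalar
  multiples of one another, hence all have the same image of a subspace \<open>W\<close>; the union in
  \<open>PGL_act\<close> is that common image.\<close>

definition GL_act :: "('v \<Rightarrow> 'v) \<Rightarrow> 'v set \<Rightarrow> 'v set" where
  "GL_act g W = g ` W"

definition PGL_act :: "('v \<Rightarrow> 'v) set \<Rightarrow> 'v set \<Rightarrow> 'v set" where
  "PGL_act c W = (\<Union>g\<in>c. GL_act g W)"

text \<open>In the following, \<open>act\<close> is an action of a group \<open>G\<close> on the subspaces of the
  \<open>F\<close>-vector space \<open>V\<close>.\<close>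

definition invariant_subspaces ::
    "('a, 'r) ring_scheme \<Rightarrow> ('a, 'v, 's) module_scheme \<Rightarrow> ('g \<Rightarrow> 'v set \<Rightarrow> 'v set)
      \<Rightarrow> 'g set \<Rightarrow> 'v set set" where
  "invariant_subspaces F V act H = {W. submodule W F V \<and> (\<forall>h\<in>H. act h W = W)}"

definition closed_subgroup ::
    "('a, 'r) ring_scheme \<Rightarrow> ('a, 'v, 's) module_scheme \<Rightarrow> ('g, 'm) monoid_scheme
      \<Rightarrow> ('g \<Rightarrow> 'v set \<Rightarrow> 'v set) \<Rightarrow> 'g set \<Rightarrow> bool" where
  "closed_subgroup F V G act H \<longleftrightarrow>
    subgroup H G \<and> H = {g \<in> carrier G. \<forall>W\<in>invariant_subspaces F V act H. act g W = W}"

definition inclusion_order :: "'b set set \<Rightarrow> 'b set gorder" where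
  "inclusion_order S = \<lparr>carrier = S, eq = (=), le = (\<subseteq>)\<rparr>"

definition product_order :: "'i set \<Rightarrow> ('i \<Rightarrow> 'b gorder) \<Rightarrow> ('i \<Rightarrow> 'b) gorder" where
  "product_order I C =
    \<lparr>carrier = (\<Pi>\<^sub>E i\<in>I. carrier (C i)), eq = (=), le = (\<lambda>x y. \<forall>i\<in>I. x i \<sqsubseteq>\<^bsub>C i\<^esub> y i)\<rparr>"

definition order_isomorphic :: "('a, 'r) gorder_scheme \<Rightarrow> ('b, 's) gorder_scheme \<Rightarrow> bool" where
  "order_isomorphic L M \<longleftrightarrow>
    (\<exists>f. bij_betw f (carrier L) (carrier M) \<and> isotone L M f \<and> isotone M L (inv_into (carrier L) f))"

text \<open>Every finite chain has an isomorphic copy carried by a set of natural numbers, so there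
  is no loss in taking the index set and the chains on \<open>nat\<close>.\<close>

definition is_product_of_finite_chains :: "('a, 'r) gorder_scheme \<Rightarrow> bool" where
  "is_product_of_finite_chains L \<longleftrightarrow>
    (\<exists>(I :: nat set) (C :: nat \<Rightarrow> nat gorder).
       finite I \<and> (\<forall>i\<in>I. total_order (C i) \<and> finite (carrier (C i))) \<and>
       order_isomorphic L (product_order I C))"

definition chain_product_subgroups ::
    "('a, 'r) ring_scheme \<Rightarrow> ('a, 'v, 's) module_scheme \<Rightarrow> ('g, 'm) monoid_scheme
      \<Rightarrow> ('g \<Rightarrow> 'v set \<Rightarrow> 'v set) \<Rightarrow> 'g set set" where
  "chain_product_subgroups F V G act =
    {H. closed_subgroup F V G act H \<and>
        is_product_of_finite_chains (inclusion_order (invariant_subspaces F V act H))}"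

definition count_of_index ::
    "('a, 'r) ring_scheme \<Rightarrow> ('a, 'v, 's) module_scheme \<Rightarrow> ('g, 'm) monoid_scheme
      \<Rightarrow> ('g \<Rightarrow> 'v set \<Rightarrow> 'v set) \<Rightarrow> nat \<Rightarrow> nat" where
  "count_of_index F V G act m =
    card {H \<in> chain_product_subgroups F V G act. card (rcosets\<^bsub>G\<^esub> H) = m}"

text \<open>A bound uniform in \<open>q\<close> has to quantify over finite fields inside the existential
  quantifier for the exponent, so the field cannot be a type variable. It ranges over records of
  type \<open>nat ring\<close>: every finite field is isomorphic to one carried by a set of natural numbers,
  and \<open>count_of_index\<close> is invariant under field isomorphism.\<close>

end

theory Submission
  imports Defs
begin

text \<open>
  Write \<open>q\<close> for the number of scalars, so that \<open>V\<close> has \<open>q ^ n\<close> elements, and let \<open>H\<close> be a closed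
  subgroup of index \<open>m\<close> whose lattice \<open>L\<close> of invariant subspaces is a product of chains.
  The idea is that \<open>H\<close> is determined by just two flags, and that there are few flags to choose from.

  A product of chains \<open>C\<^sub>1 \<times> \<dots> \<times> C\<^sub>r\<close> is generated by two chains: one fills up the
  factors from the first to the last, the other from the last to the first
  (\<open>generating_chains\<close>). In \<open>L\<close> these are two flags \<open>\<A>\<close> and \<open>\<B>\<close> of subspaces. Whatever fixes all
  members of \<open>\<A>\<close> and \<open>\<B>\<close> fixes their intersections and sums, hence all of \<open>L\<close>; as \<open>H\<close> is closed,
  \<open>H\<close> is exactly the stabilizer of the two flags (\<open>chain_product_subgroup_flags\<close>).

  Since \<open>GL F V\<close> is transitive on the flags of a given type (\<open>GL_transitive_on_flags\<close>), the flags of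
  the type of \<open>\<A>\<close> form one orbit. Its length is at most \<open>m\<close> because \<open>H\<close> fixes \<open>\<A>\<close>. There
  are at most \<open>2 ^ (n + 1)\<close> types, so at most \<open>2 ^ (n + 1) * m\<close> flags can occur, and at
  most \<open>(2 ^ (n + 1) * m)\<^sup>2\<close> subgroups (\<open>count_le_flag_pairs\<close>).

  It remains to bound \<open>2 ^ n\<close> by a power of \<open>m\<close>. If \<open>H\<close> is not the whole group, then it fixes a proper
  nonzero subspace \<open>W\<close>, and \<open>m\<close> is at least the number \<open>N\<close> of subspaces of the same dimension \<open>k\<close>.
  These subspaces cover \<open>V\<close>, which gives \<open>N \<ge> q ^ (n - k)\<close>, and among them are the graphs of linear
  maps from \<open>W\<close> to a line outside \<open>W\<close>, which gives \<open>N \<ge> q ^ k\<close>. Therefore \<open>m\<^sup>2 \<ge> q ^ n \<ge> 2 ^ n\<close>. As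
  \<open>m \<ge> 2\<close>, the count is at most \<open>(m * m\<^sup>2 * m)\<^sup>2 = m ^ 8\<close>. For \<open>m = 1\<close> only the whole group is counted.

  The two groups are treated together by a locale for group actions on subspaces whose image is that
  of \<open>GL F V\<close>; for \<open>PGL F V\<close> this needs that the center of \<open>GL F V\<close> fixes every subspace.
\<close>

section \<open>Subspaces of a finite vector space\<close>

locale finite_vector_space = module F V + field F
  for F :: "('a, 'r) ring_scheme" (structure) and V :: "('a, 'v, 's) module_scheme" (structure) +
  assumes finite_scalars: "finite (carrier F)" and finite_vectors: "finite (carrier V)"
begin

abbreviation subspace :: "'v set \<Rightarrow> bool" where
  "subspace W \<equiv> submodule W F V"

definition adjoin :: "'v set \<Rightarrow> 'v \<Rightarrow> 'v set" where
  "adjoin A x = (\<lambda>(a, c). a \<oplus>\<^bsub>V\<^esub> c \<odot>\<^bsub>V\<^esub> x) ` (A \<times> carrier F)"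

lemma subspace_subset: "subspace A \<Longrightarrow> A \<subseteq> carrier V"
  by (rule submoduleE(1))

lemma subspace_mem: "subspace A \<Longrightarrow> a \<in> A \<Longrightarrow> a \<in> carrier V"
  using submoduleE(1) by blast

lemma subspace_zero: "subspace A \<Longrightarrow> \<zero>\<^bsub>V\<^esub> \<in> A"
  using subgroup.one_closed[OF submodule.axioms(1), of A F V] by simp

lemma finite_subspace: "subspace A \<Longrightarrow> finite A"
  using subspace_subset finite_subset finite_vectors by blast

lemma zero_subspace: "subspace {\<zero>\<^bsub>V\<^esub>}"
  by (rule submoduleI) auto

lemma subspace_Inter:
  assumes "S \<noteq> {}" "\<And>A. A \<in> S \<Longrightarrow> subspace A"
  shows "subspace (\<Inter>S)"
  using assms
  by (intro submoduleI) (auto simp: subspace_zero submoduleE(3-5) dest: subspace_mem)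

lemma subspace_Int:
  assumes "subspace A" "subspace B"
  shows "subspace (A \<inter> B)"
  using subspace_Inter[of "{A, B}"] assms by auto

definition subspace_hull :: "'v set \<Rightarrow> 'v set" where
  "subspace_hull S = \<Inter>{U. subspace U \<and> S \<subseteq> U}"

lemma hull_subspace: "S \<subseteq> carrier V \<Longrightarrow> subspace (subspace_hull S)"
  unfolding subspace_hull_def using carrier_is_submodule by (intro subspace_Inter) auto

lemma subset_hull: "S \<subseteq> subspace_hull S"
  unfolding subspace_hull_def by blast

lemma hull_least: "subspace U \<Longrightarrow> S \<subseteq> U \<Longrightarrow> subspace_hull S \<subseteq> U"
  unfolding subspace_hull_def by blast

lemma subspace_eqI: "subspace B \<Longrightarrow> A \<subseteq> B \<Longrightarrow> card A = card B \<Longrightarrow> A = B"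
  using card_subset_eq finite_subspace by blast

lemma add_cancel_mem:
  assumes "subspace A" "a \<in> A" "b \<in> carrier V" "a \<oplus>\<^bsub>V\<^esub> b \<in> A"
  shows "b \<in> A"
proof -
  have "b = \<ominus>\<^bsub>V\<^esub> a \<oplus>\<^bsub>V\<^esub> (a \<oplus>\<^bsub>V\<^esub> b)"
    using assms subspace_mem[OF assms(1)] by (simp add: M.r_neg1)
  then show ?thesis
    using assms submoduleE(3,5)[OF assms(1)] by metis
qed

lemma smult_cancel_mem:
  assumes "subspace A" "c \<in> carrier F" "c \<noteq> \<zero>" "x \<in> carrier V" "c \<odot>\<^bsub>V\<^esub> x \<in> A"
  shows "x \<in> A"
proof -
  have "x = inv c \<odot>\<^bsub>V\<^esub> (c \<odot>\<^bsub>V\<^esub> x)"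
    using assms by (simp add: smult_assoc1[symmetric] field_Units)
  then show ?thesis
    using assms submoduleE(4)[OF assms(1)] by (metis DiffI Units_inv_closed empty_iff field_Units insert_iff)
qed

lemma adjoin_unique:
  assumes A: "subspace A" and x: "x \<in> carrier V" "x \<notin> A"
    and a: "a \<in> A" "a' \<in> A" and c: "c \<in> carrier F" "c' \<in> carrier F"
    and eq: "a \<oplus>\<^bsub>V\<^esub> c \<odot>\<^bsub>V\<^esub> x = a' \<oplus>\<^bsub>V\<^esub> c' \<odot>\<^bsub>V\<^esub> x"
  shows "a = a' \<and> c = c'"
proof -
  have V: "a \<in> carrier V" "a' \<in> carrier V" using A a subspace_mem by auto
  have "a' \<oplus>\<^bsub>V\<^esub> (c' \<ominus> c) \<odot>\<^bsub>V\<^esub> x = a' \<oplus>\<^bsub>V\<^esub> c' \<odot>\<^bsub>V\<^esub> x \<oplus>\<^bsub>V\<^esub> \<ominus>\<^bsub>V\<^esub> (c \<odot>\<^bsub>V\<^esub> x)"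
    using V c x by (simp add: R.minus_eq smult_l_distr smult_l_minus M.a_assoc)
  also have "\<dots> = a" using V c x by (simp add: eq[symmetric] M.a_assoc M.r_neg)
  finally have "(c' \<ominus> c) \<odot>\<^bsub>V\<^esub> x \<in> A"
    using add_cancel_mem[OF A a(2), of "(c' \<ominus> c) \<odot>\<^bsub>V\<^esub> x"] a c x by simp
  then have "c' \<ominus> c = \<zero>"
    using smult_cancel_mem[OF A _ _ x(1)] c x by (meson R.minus_closed)
  then have "c = c'" using c by (simp add: R.r_right_minus_eq)
  then show ?thesis using eq V c x by simp
qed

lemma adjoin_mem: "a \<in> A \<Longrightarrow> c \<in> carrier F \<Longrightarrow> a \<oplus>\<^bsub>V\<^esub> c \<odot>\<^bsub>V\<^esub> x \<in> adjoin A x"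
  unfolding adjoin_def by force

lemma adjoinE:
  assumes "y \<in> adjoin A x"
  obtains a c where "a \<in> A" "c \<in> carrier F" "y = a \<oplus>\<^bsub>V\<^esub> c \<odot>\<^bsub>V\<^esub> x"
  using assms unfolding adjoin_def by force

lemma combination_add:
  assumes "a \<in> carrier V" "b \<in> carrier V" "c \<in> carrier F" "d \<in> carrier F" "x \<in> carrier V"
  shows "(a \<oplus>\<^bsub>V\<^esub> c \<odot>\<^bsub>V\<^esub> x) \<oplus>\<^bsub>V\<^esub> (b \<oplus>\<^bsub>V\<^esub> d \<odot>\<^bsub>V\<^esub> x) = (a \<oplus>\<^bsub>V\<^esub> b) \<oplus>\<^bsub>V\<^esub> (c \<oplus> d) \<odot>\<^bsub>V\<^esub> x"
  using assms by (simp add: smult_l_distr M.a_ac)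

lemma combination_smult:
  assumes "a \<in> carrier V" "c \<in> carrier F" "d \<in> carrier F" "x \<in> carrier V"
  shows "d \<odot>\<^bsub>V\<^esub> (a \<oplus>\<^bsub>V\<^esub> c \<odot>\<^bsub>V\<^esub> x) = d \<odot>\<^bsub>V\<^esub> a \<oplus>\<^bsub>V\<^esub> (d \<otimes> c) \<odot>\<^bsub>V\<^esub> x"
  using assms by (simp add: smult_r_distr smult_assoc1)

lemma adjoin_subspace:
  assumes "subspace A" "x \<in> carrier V"
  shows "subspace (adjoin A x)"
proof (rule submoduleI)
  note A = subspace_mem[OF assms(1)] submoduleE(3-5)[OF assms(1)] subspace_zero[OF assms(1)]
  show "adjoin A x \<subseteq> carrier V" using A assms(2) by (auto elim!: adjoinE)
  show sm: "c \<odot>\<^bsub>V\<^esub> y \<in> adjoin A x" if "c \<in> carrier F" "y \<in> adjoin A x" for c y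
    using that A assms(2) by (auto elim!: adjoinE simp: combination_smult intro!: adjoin_mem)
  show "y \<oplus>\<^bsub>V\<^esub> z \<in> adjoin A x" if "y \<in> adjoin A x" "z \<in> adjoin A x" for y z
    using that A assms(2) by (auto elim!: adjoinE simp: combination_add intro!: adjoin_mem)
  show "\<zero>\<^bsub>V\<^esub> \<in> adjoin A x" using adjoin_mem[of "\<zero>\<^bsub>V\<^esub>" A \<zero> x] A assms(2) by simp
  show "\<ominus>\<^bsub>V\<^esub> y \<in> adjoin A x" if "y \<in> adjoin A x" for y
    using sm[of "\<ominus> \<one>" y] that \<open>adjoin A x \<subseteq> carrier V\<close> smult_l_minus[of \<one> y] by (simp add: subset_iff)
qed

lemma subset_adjoin:
  assumes "subspace A" "x \<in> carrier V"
  shows "A \<subseteq> adjoin A x"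
  using adjoin_mem[of _ A \<zero> x] subspace_mem[OF assms(1)] assms(2) by auto

lemma mem_adjoin:
  assumes "subspace A" "x \<in> carrier V"
  shows "x \<in> adjoin A x"
  using adjoin_mem[of "\<zero>\<^bsub>V\<^esub>" A \<one> x] subspace_zero[OF assms(1)] assms(2) by auto

lemma adjoin_least:
  assumes "subspace U" "A \<subseteq> U" "x \<in> U"
  shows "adjoin A x \<subseteq> U"
  using assms submoduleE(4,5)[OF assms(1)] by (auto elim!: adjoinE)

lemma card_adjoin:
  assumes "subspace A" "x \<in> carrier V" "x \<notin> A"
  shows "card (adjoin A x) = card A * card (carrier F)"
proof -
  have "inj_on (\<lambda>(a, c). a \<oplus>\<^bsub>V\<^esub> c \<odot>\<^bsub>V\<^esub> x) (A \<times> carrier F)"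
    using adjoin_unique[OF assms] by (auto simp: inj_on_def)
  then show ?thesis unfolding adjoin_def by (simp add: card_image card_cartesian_product)
qed

lemma card_scalars: "2 \<le> card (carrier F)"
proof -
  have "card {\<zero>, \<one>} \<le> card (carrier F)" by (intro card_mono finite_scalars) auto
  then show ?thesis by simp
qed

text \<open>
  A finite space is reached from any of its subspaces by adjoining vectors one at a time. This
  induction takes the place of bases: since one step multiplies the cardinality by \<open>card (carrier F)\<close>,
  cardinality can serve as the measure of dimension throughout.
\<close>

lemma adjoin_chain_induct [consumes 3, case_names base adjoin]:
  assumes "subspace A" "subspace U" "A \<subseteq> U" "P A"
    and step: "\<And>B x. \<lbrakk>subspace B; A \<subseteq> B; B \<subseteq> U; x \<in> U; x \<in> carrier V; x \<notin> B; P B\<rbrakk> \<Longrightarrow> P (adjoin B x)"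
  shows "P U"
proof -
  have "P U" if "subspace B" "A \<subseteq> B" "B \<subseteq> U" "P B" for B
    using that
  proof (induction "card U - card B" arbitrary: B rule: less_induct)
    case less
    show ?case
    proof (cases "B = U")
      case False
      then obtain x where x: "x \<in> U" "x \<notin> B" using less.prems by blast
      have xV: "x \<in> carrier V" using x assms(2) subspace_mem by blast
      have sub: "subspace (adjoin B x)" "B \<subseteq> adjoin B x" "adjoin B x \<subseteq> U" "x \<in> adjoin B x"
        using less.prems x xV assms(2) adjoin_subspace subset_adjoin adjoin_least mem_adjoin by auto
      have "card B < card (adjoin B x)"
        using sub x by (intro psubset_card_mono finite_subspace) auto
      moreover have "card (adjoin B x) \<le> card U"
        using sub assms(2) by (intro card_mono finite_subspace)
      ultimately show ?thesis
        using less.hyps[of "adjoin B x"] sub less.prems step[of B x] x xV by force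
    qed (use less.prems in simp)
  qed
  then show ?thesis using assms by blast
qed

lemma card_subspace_power:
  assumes "subspace W"
  shows "\<exists>k. card W = card (carrier F) ^ k"
proof -
  have "{\<zero>\<^bsub>V\<^esub>} \<subseteq> W" using subspace_zero[OF assms] by simp
  with zero_subspace assms show ?thesis
  proof (induction rule: adjoin_chain_induct)
    case base
    then show ?case by (simp add: exI[of _ 0])
  next
    case (adjoin B x)
    then show ?case using card_adjoin[of B x] by (metis power_Suc2)
  qed
qed

section \<open>Extension of partial isomorphisms\<close>

definition lin_iso :: "('v \<Rightarrow> 'v) \<Rightarrow> 'v set \<Rightarrow> 'v set \<Rightarrow> bool" where
  "lin_iso \<phi> A B \<longleftrightarrow> bij_betw \<phi> A B \<and> (\<forall>u\<in>A. \<forall>v\<in>A. \<phi> (u \<oplus>\<^bsub>V\<^esub> v) = \<phi> u \<oplus>\<^bsub>V\<^esub> \<phi> v) \<and>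
     (\<forall>c\<in>carrier F. \<forall>v\<in>A. \<phi> (c \<odot>\<^bsub>V\<^esub> v) = c \<odot>\<^bsub>V\<^esub> \<phi> v)"

lemma lin_iso_id: "lin_iso (\<lambda>v. v) A A"
  unfolding lin_iso_def bij_betw_def by simp

lemma lin_iso_adjoin:
  assumes A: "subspace A" "x \<in> carrier V" "x \<notin> A"
    and B: "subspace B" "y \<in> carrier V" "y \<notin> B"
    and \<phi>: "lin_iso \<phi> A B"
  obtains \<psi> where "lin_iso \<psi> (adjoin A x) (adjoin B y)" "\<And>a. a \<in> A \<Longrightarrow> \<psi> a = \<phi> a" "\<psi> x = y"
proof -
  \<comment> \<open>\<open>dec\<close> reads off the coordinates of a vector of \<open>adjoin A x\<close>, which are unique as \<open>x \<notin> A\<close>.\<close>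
  define dec where "dec = inv_into (A \<times> carrier F) (\<lambda>(a, c). a \<oplus>\<^bsub>V\<^esub> c \<odot>\<^bsub>V\<^esub> x)"
  define \<psi> where "\<psi> v = (case dec v of (a, c) \<Rightarrow> \<phi> a \<oplus>\<^bsub>V\<^esub> c \<odot>\<^bsub>V\<^esub> y)" for v
  have injA: "inj_on (\<lambda>(a, c). a \<oplus>\<^bsub>V\<^esub> c \<odot>\<^bsub>V\<^esub> x) (A \<times> carrier F)"
    using adjoin_unique[OF A] by (auto simp: inj_on_def)
  have \<psi>: "\<psi> (a \<oplus>\<^bsub>V\<^esub> c \<odot>\<^bsub>V\<^esub> x) = \<phi> a \<oplus>\<^bsub>V\<^esub> c \<odot>\<^bsub>V\<^esub> y" if "a \<in> A" "c \<in> carrier F" for a c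
    using inv_into_f_f[OF injA, of "(a, c)"] that unfolding \<psi>_def dec_def by simp
  have bij: "bij_betw \<phi> A B"
    and add: "\<And>u v. u \<in> A \<Longrightarrow> v \<in> A \<Longrightarrow> \<phi> (u \<oplus>\<^bsub>V\<^esub> v) = \<phi> u \<oplus>\<^bsub>V\<^esub> \<phi> v"
    and sm: "\<And>c v. c \<in> carrier F \<Longrightarrow> v \<in> A \<Longrightarrow> \<phi> (c \<odot>\<^bsub>V\<^esub> v) = c \<odot>\<^bsub>V\<^esub> \<phi> v"
    using \<phi> unfolding lin_iso_def by auto
  have \<phi>B: "\<phi> a \<in> B" if "a \<in> A" for a using bij that bij_betwE by blast
  have \<phi>V: "\<phi> a \<in> carrier V" if "a \<in> A" for a using \<phi>B that subspace_mem[OF B(1)] by blast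
  note cl = subspace_mem[OF A(1)] submoduleE(4,5)[OF A(1)]
  have "\<psi> ` adjoin A x = adjoin B y"
  proof
    show "\<psi> ` adjoin A x \<subseteq> adjoin B y" using \<phi>B by (auto elim!: adjoinE simp: \<psi> intro!: adjoin_mem)
    show "adjoin B y \<subseteq> \<psi> ` adjoin A x"
    proof
      fix v assume "v \<in> adjoin B y"
      then obtain b c where "b \<in> B" "c \<in> carrier F" "v = b \<oplus>\<^bsub>V\<^esub> c \<odot>\<^bsub>V\<^esub> y" by (rule adjoinE)
      moreover then obtain a where "a \<in> A" "b = \<phi> a" using bij by (auto simp: bij_betw_def)
      ultimately show "v \<in> \<psi> ` adjoin A x" using \<psi> adjoin_mem by (metis imageI)
    qed
  qed
  moreover have "inj_on \<psi> (adjoin A x)"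
  proof (rule inj_onI)
    fix u v assume "u \<in> adjoin A x" "v \<in> adjoin A x" and eq: "\<psi> u = \<psi> v"
    then obtain a c b d where *: "a \<in> A" "c \<in> carrier F" "u = a \<oplus>\<^bsub>V\<^esub> c \<odot>\<^bsub>V\<^esub> x"
      "b \<in> A" "d \<in> carrier F" "v = b \<oplus>\<^bsub>V\<^esub> d \<odot>\<^bsub>V\<^esub> x" by (metis adjoinE)
    then have "\<phi> a = \<phi> b \<and> c = d" using eq adjoin_unique[OF B \<phi>B \<phi>B] by (simp add: \<psi>)
    then show "u = v" using * bij by (auto simp: bij_betw_def inj_on_def)
  qed
  moreover have "\<psi> (u \<oplus>\<^bsub>V\<^esub> v) = \<psi> u \<oplus>\<^bsub>V\<^esub> \<psi> v" if "u \<in> adjoin A x" "v \<in> adjoin A x" for u v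
    using that cl A(2) B(2)
    by (auto elim!: adjoinE simp: combination_add \<psi> add \<phi>V)
  moreover have "\<psi> (c \<odot>\<^bsub>V\<^esub> v) = c \<odot>\<^bsub>V\<^esub> \<psi> v" if "c \<in> carrier F" "v \<in> adjoin A x" for c v
    using that cl A(2) B(2)
    by (auto elim!: adjoinE simp: combination_smult \<psi> sm \<phi>V)
  ultimately have "lin_iso \<psi> (adjoin A x) (adjoin B y)"
    unfolding lin_iso_def bij_betw_def by blast
  moreover have ext: "\<psi> a = \<phi> a" if "a \<in> A" for a
    using \<psi>[OF that R.zero_closed] that cl A(2) B(2) \<phi>V by simp
  moreover have "\<phi> \<zero>\<^bsub>V\<^esub> = \<zero>\<^bsub>V\<^esub>"
    using sm[OF R.zero_closed subspace_zero[OF A(1)]] \<phi>V[OF subspace_zero[OF A(1)]] by simp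
  then have "\<psi> x = y"
    using \<psi>[OF subspace_zero[OF A(1)] R.one_closed] A(2) B(2) by simp
  ultimately show thesis using that by blast
qed

text \<open>
  Adjoining a vector multiplies the cardinalities of domain and image by the same factor. So an
  extension one vector at a time never gets stuck: as long as \<open>U\<close> is not exhausted, neither is \<open>W\<close>.
\<close>

lemma lin_iso_extend:
  assumes A: "subspace A" "subspace U" "A \<subseteq> U" and B: "subspace B" "subspace W" "B \<subseteq> W"
    and card: "card U = card W" and \<phi>: "lin_iso \<phi> A B"
  obtains \<psi> where "lin_iso \<psi> U W" "\<And>a. a \<in> A \<Longrightarrow> \<psi> a = \<phi> a"
proof -
  \<comment> \<open>A partial extension with domain properly inside \<open>U\<close> has an image \<open>T\<close> with fewer elements
    than \<open>W\<close>, which yields the vector \<open>y\<close> to which the next vector \<open>x\<close> is sent.\<close>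
  have "\<exists>\<psi> T. subspace T \<and> T \<subseteq> W \<and> lin_iso \<psi> U T \<and> (\<forall>a\<in>A. \<psi> a = \<phi> a)"
    using A
  proof (induction rule: adjoin_chain_induct)
    case base
    then show ?case using B \<phi> by blast
  next
    case (adjoin C x)
    then obtain \<psi> T where *: "subspace T" "T \<subseteq> W" "lin_iso \<psi> C T" "\<forall>a\<in>A. \<psi> a = \<phi> a" by blast
    have "card T = card C" using *(3) by (metis lin_iso_def bij_betw_same_card)
    moreover have "card C < card U"
      using adjoin by (intro psubset_card_mono finite_subspace A) auto
    ultimately have "T \<noteq> W" using card by auto
    then obtain y where y: "y \<in> W" "y \<notin> T" using *(2) by blast
    have yV: "y \<in> carrier V" using y B subspace_mem by blast
    obtain \<psi>' where "lin_iso \<psi>' (adjoin C x) (adjoin T y)" "\<And>a. a \<in> C \<Longrightarrow> \<psi>' a = \<psi> a"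
      using lin_iso_adjoin[of C x T y \<psi>] adjoin * y yV by blast
    moreover have "subspace (adjoin T y)" "adjoin T y \<subseteq> W"
      using adjoin_subspace adjoin_least * y yV B by auto
    ultimately show ?case using *(4) adjoin(2) by (metis subsetD)
  qed
  then obtain \<psi> T where *: "subspace T" "T \<subseteq> W" "lin_iso \<psi> U T" "\<forall>a\<in>A. \<psi> a = \<phi> a" by blast
  have "card T = card U" using *(3) by (metis lin_iso_def bij_betw_same_card)
  then have "T = W" using * card subspace_eqI B by simp
  then show thesis using * that by blast
qed

lemma restrict_lin_iso_GL:
  assumes "lin_iso \<psi> (carrier V) (carrier V)"
  shows "restrict \<psi> (carrier V) \<in> carrier (GL F V)"
proof -
  have "bij_betw (restrict \<psi> (carrier V)) (carrier V) (carrier V)"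
    using assms unfolding lin_iso_def by simp
  then show ?thesis
    using assms unfolding GL_def linear_maps_def Bij_def lin_iso_def by (auto dest: bij_betwE)
qed

lemma GL_lin_iso: "g \<in> carrier (GL F V) \<Longrightarrow> lin_iso g (carrier V) (carrier V)"
  unfolding GL_def linear_maps_def Bij_def lin_iso_def by auto


lemma lin_iso_extend_GL:
  assumes "subspace A" "subspace B" "lin_iso \<phi> A B"
  obtains g where "g \<in> carrier (GL F V)" "\<And>a. a \<in> A \<Longrightarrow> g a = \<phi> a"
proof -
  obtain \<psi> where "lin_iso \<psi> (carrier V) (carrier V)" and \<psi>: "\<And>a. a \<in> A \<Longrightarrow> \<psi> a = \<phi> a"
    using lin_iso_extend[OF assms(1) carrier_is_submodule _ assms(2) carrier_is_submodule _ _ assms(3)]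
      subspace_subset assms by blast
  then show thesis
    using that[OF restrict_lin_iso_GL] subspace_mem[OF assms(1)] by simp
qed

lemma GL_image_subspace:
  assumes g: "g \<in> carrier (GL F V)" and W: "subspace W"
  shows "subspace (g ` W)"
proof -
  have bij: "bij_betw g (carrier V) (carrier V)"
    and add: "\<And>u v. u \<in> carrier V \<Longrightarrow> v \<in> carrier V \<Longrightarrow> g (u \<oplus>\<^bsub>V\<^esub> v) = g u \<oplus>\<^bsub>V\<^esub> g v"
    and sm: "\<And>c v. c \<in> carrier F \<Longrightarrow> v \<in> carrier V \<Longrightarrow> g (c \<odot>\<^bsub>V\<^esub> v) = c \<odot>\<^bsub>V\<^esub> g v"
    using GL_lin_iso[OF g] unfolding lin_iso_def by auto
  have gV: "g v \<in> carrier V" if "v \<in> carrier V" for v using bij that bij_betwE by blast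
  note W' = subspace_mem[OF W] submoduleE(4,5)[OF W] subspace_zero[OF W]
  show ?thesis
  proof (rule submoduleI)
    show sub: "g ` W \<subseteq> carrier V" using gV W' by auto
    show smW: "c \<odot>\<^bsub>V\<^esub> x \<in> g ` W" if "c \<in> carrier F" "x \<in> g ` W" for c x
      using that W' by (auto simp: sm[symmetric])
    show "x \<oplus>\<^bsub>V\<^esub> y \<in> g ` W" if "x \<in> g ` W" "y \<in> g ` W" for x y
      using that W' by (auto simp: add[symmetric])
    show "\<zero>\<^bsub>V\<^esub> \<in> g ` W" using smW[of \<zero> "g \<zero>\<^bsub>V\<^esub>"] W' gV by simp
    show "\<ominus>\<^bsub>V\<^esub> x \<in> g ` W" if "x \<in> g ` W" for x
      using smW[of "\<ominus> \<one>" x] that sub smult_l_minus[of \<one> x] by (simp add: subset_iff)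
  qed
qed

lemma GL_image_card:
  assumes "g \<in> carrier (GL F V)" "subspace W"
  shows "card (g ` W) = card W"
  using GL_lin_iso[OF assms(1)] subspace_subset[OF assms(2)]
  unfolding lin_iso_def bij_betw_def by (meson card_image inj_on_subset)

section \<open>Transitivity on flags\<close>

text \<open>
  Flags are sets of subspaces rather than lists, and may contain the zero space and the whole space.
  The set \<open>card ` \<F>\<close> of cardinalities is then the type of a flag \<open>\<F>\<close>.
\<close>

definition flag :: "'v set set \<Rightarrow> bool" where
  "flag \<F> \<longleftrightarrow> (\<forall>W\<in>\<F>. subspace W) \<and> (\<forall>W\<in>\<F>. \<forall>U\<in>\<F>. W \<subseteq> U \<or> U \<subseteq> W)"

lemma finite_subspaces: "finite {W. subspace W}"
  using finite_subset[of "{W. subspace W}" "Pow (carrier V)"] finite_vectors subspace_subset by blast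

lemma flag_subset:
  assumes "flag \<F>" "W \<in> \<F>" "U \<in> \<F>" "card W \<le> card U"
  shows "W \<subseteq> U"
  using assms unfolding flag_def by (metis card_seteq finite_subspace)

text \<open>
  The isomorphism is built from the smallest member of the flag upwards: its domain \<open>T\<close> is the largest
  member treated so far, or the zero space at the start, and lies in the next member, so that
  the extension property applies. Equal types ensure that both flags proceed in step.
\<close>

lemma flag_iso:
  fixes D :: "nat set"
  assumes "finite D" "flag \<F>" "flag \<F>'" "card ` \<F> = D" "card ` \<F>' = D"
  shows "\<exists>\<phi> T T'. lin_iso \<phi> T T' \<and> T \<in> insert {\<zero>\<^bsub>V\<^esub>} \<F> \<and> T' \<in> insert {\<zero>\<^bsub>V\<^esub>} \<F>' \<and>
    (\<forall>W\<in>\<F>. \<forall>W'\<in>\<F>'. card W = card W' \<longrightarrow> W \<subseteq> T \<and> \<phi> ` W = W')"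
  using assms
proof (induction D arbitrary: \<F> \<F>' rule: finite_linorder_max_induct)
  case empty
  then show ?case using lin_iso_id by (intro exI[of _ "\<lambda>v. v"] exI[of _ "{\<zero>\<^bsub>V\<^esub>}"]) simp
next
  case (insert b D)
  have sub: "\<And>W. W \<in> \<F> \<Longrightarrow> subspace W" "\<And>W. W \<in> \<F>' \<Longrightarrow> subspace W"
    using insert.prems unfolding flag_def by auto
  obtain U where U: "U \<in> \<F>" "card U = b" using insert.prems by (metis imageE insertI1)
  obtain U' where U': "U' \<in> \<F>'" "card U' = b" using insert.prems by (metis imageE insertI1)
  let ?\<E> = "{W \<in> \<F>. card W \<in> D}" and ?\<E>' = "{W \<in> \<F>'. card W \<in> D}"
  have "\<exists>\<phi> T T'. lin_iso \<phi> T T' \<and> T \<in> insert {\<zero>\<^bsub>V\<^esub>} ?\<E> \<and> T' \<in> insert {\<zero>\<^bsub>V\<^esub>} ?\<E>' \<and>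
    (\<forall>W\<in>?\<E>. \<forall>W'\<in>?\<E>'. card W = card W' \<longrightarrow> W \<subseteq> T \<and> \<phi> ` W = W')"
    using insert.prems by (intro insert.IH) (auto simp: flag_def)
  then obtain \<phi> T T' where \<phi>: "lin_iso \<phi> T T'"
    and T: "T \<in> insert {\<zero>\<^bsub>V\<^esub>} ?\<E>" "T' \<in> insert {\<zero>\<^bsub>V\<^esub>} ?\<E>'"
    and maps: "\<forall>W\<in>?\<E>. \<forall>W'\<in>?\<E>'. card W = card W' \<longrightarrow> W \<subseteq> T \<and> \<phi> ` W = W'"
    by (elim exE conjE) (rule that)
  have below: "S \<subseteq> U" if "flag \<G>" "U \<in> \<G>" "card U = b" "S \<in> insert {\<zero>\<^bsub>V\<^esub>} {W \<in> \<G>. card W \<in> D}" for \<G> S U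
  proof (cases "S = {\<zero>\<^bsub>V\<^esub>}")
    case True
    then show ?thesis using that subspace_zero[of U] by (simp add: flag_def)
  next
    case False
    then show ?thesis using that flag_subset[of \<G> S U] insert.hyps(2) by (simp add: less_imp_le)
  qed
  have "T \<subseteq> U" "T' \<subseteq> U'" using below insert.prems U U' T by auto
  moreover have "subspace T" "subspace T'" using T sub zero_subspace by auto
  ultimately obtain \<psi> where \<psi>: "lin_iso \<psi> U U'" "\<And>a. a \<in> T \<Longrightarrow> \<psi> a = \<phi> a"
    using lin_iso_extend[of T U T' U' \<phi>] U U' sub \<phi> by metis
  have "W \<subseteq> U \<and> \<psi> ` W = W'" if W: "W \<in> \<F>" "W' \<in> \<F>'" "card W = card W'" for W W'
  proof (cases "card W = b")
    case True
    then have "W = U" "W' = U'"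
      using W U U' flag_subset[of \<F> W U] flag_subset[of \<F> U W] flag_subset[of \<F>' W' U']
        flag_subset[of \<F>' U' W'] insert.prems True by auto
    then show ?thesis using \<psi>(1) unfolding lin_iso_def bij_betw_def by simp
  next
    case False
    then have "card W \<in> D" using W(1) insert.prems(3) by auto
    then have "W \<subseteq> T \<and> \<phi> ` W = W'" using maps W by simp
    moreover from this have "\<psi> ` W = \<phi> ` W" using \<psi>(2) by (intro image_cong) auto
    ultimately show ?thesis using \<open>T \<subseteq> U\<close> by (metis subset_trans)
  qed
  then show ?case using \<psi>(1) U U' by blast
qed

text \<open>
  By transitivity, the number of flags of a given type is an orbit length, which is at most
  the index of any subgroup that fixes one such flag.
\<close>

lemma GL_transitive_on_flags:
  assumes "flag \<F>" "flag \<F>'" "card ` \<F> = card ` \<F>'"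
  obtains g where "g \<in> carrier (GL F V)" "(`) g ` \<F> = \<F>'"
proof -
  have fin: "finite (card ` \<F>)"
    using assms(1) finite_subset[OF _ finite_subspaces] unfolding flag_def by blast
  obtain \<phi> T T' where \<phi>: "lin_iso \<phi> T T'"
    and T: "T \<in> insert {\<zero>\<^bsub>V\<^esub>} \<F>" "T' \<in> insert {\<zero>\<^bsub>V\<^esub>} \<F>'"
    and maps: "\<forall>W\<in>\<F>. \<forall>W'\<in>\<F>'. card W = card W' \<longrightarrow> W \<subseteq> T \<and> \<phi> ` W = W'"
    using flag_iso[OF fin assms(1,2) refl assms(3)[symmetric]] by (elim exE conjE) (rule that)
  have "subspace T" "subspace T'" using T assms zero_subspace unfolding flag_def by auto
  then obtain g where g: "g \<in> carrier (GL F V)" "\<And>a. a \<in> T \<Longrightarrow> g a = \<phi> a"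
    using lin_iso_extend_GL \<phi> by blast
  have image: "g ` W = W'" if "W \<in> \<F>" "W' \<in> \<F>'" "card W = card W'" for W W'
  proof -
    have "W \<subseteq> T" "\<phi> ` W = W'" using maps that by auto
    then show ?thesis using g(2) by (metis image_cong subsetD)
  qed
  have "\<exists>W'\<in>\<F>'. g ` W = W'" if "W \<in> \<F>" for W
  proof -
    have "card W \<in> card ` \<F>'" using that assms(3) by blast
    then show ?thesis using image[OF that] by auto
  qed
  moreover have "\<exists>W\<in>\<F>. g ` W = W'" if "W' \<in> \<F>'" for W'
  proof -
    have "card W' \<in> card ` \<F>" using that assms(3) by blast
    then obtain W where "W \<in> \<F>" "card W = card W'" by auto
    then show ?thesis using image[OF _ that] by blast
  qed
  ultimately have "(`) g ` \<F> = \<F>'" by blast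
  with g show thesis using that by blast
qed

section \<open>The number of subspaces of a given dimension\<close>

text \<open>
  This bound and its dual \<open>card_Grassmannian_ge_dim\<close> say that for \<open>q = card (carrier F)\<close> the number
  of subspaces of dimension \<open>k\<close> in dimension \<open>n\<close> is at least \<open>q ^ (n - k)\<close> and at least \<open>q ^ k\<close>.
  The first holds because these subspaces cover the space: \<open>GL F V\<close> moves a nonzero vector of \<open>W\<close>
  to any other nonzero vector.
\<close>

lemma card_Grassmannian_ge_codim:
  assumes W: "subspace W" "W \<noteq> {\<zero>\<^bsub>V\<^esub>}"
  shows "card (carrier V) \<le> card {U. subspace U \<and> card U = card W} * card W"
proof -
  let ?N = "{U. subspace U \<and> card U = card W}"
  obtain w where w: "w \<in> W" "w \<noteq> \<zero>\<^bsub>V\<^esub>" using W subspace_zero by blast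
  have wV: "w \<in> carrier V" using w W subspace_mem by blast
  have "carrier V \<subseteq> \<Union>?N"
  proof
    fix v assume v: "v \<in> carrier V"
    show "v \<in> \<Union>?N"
    proof (cases "v = \<zero>\<^bsub>V\<^esub>")
      case True
      then show ?thesis using W subspace_zero by auto
    next
      case False
      then obtain \<psi> where "lin_iso \<psi> (adjoin {\<zero>\<^bsub>V\<^esub>} w) (adjoin {\<zero>\<^bsub>V\<^esub>} v)" "\<psi> w = v"
        using lin_iso_adjoin[OF zero_subspace wV _ zero_subspace v _ lin_iso_id] w by auto
      then obtain g where g: "g \<in> carrier (GL F V)" "g w = v"
        using lin_iso_extend_GL[of "adjoin {\<zero>\<^bsub>V\<^esub>} w" "adjoin {\<zero>\<^bsub>V\<^esub>} v" \<psi>]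
          adjoin_subspace[OF zero_subspace] mem_adjoin[OF zero_subspace] v wV by metis
      then have "v \<in> g ` W" "g ` W \<in> ?N"
        using w GL_image_subspace[OF g(1) W(1)] GL_image_card[OF g(1) W(1)] by auto
      then show ?thesis by blast
    qed
  qed
  moreover have "finite ?N" using finite_subspaces by simp
  moreover from this have "finite (\<Union>?N)" using finite_subspace by blast
  ultimately have "card (carrier V) \<le> card (\<Union>?N)" by (intro card_mono)
  also have "\<dots> \<le> (\<Sum>U\<in>?N. card U)" by (rule card_Union_le_sum_card)
  also have "\<dots> = card ?N * card W" by simp
  finally show ?thesis .
qed

lemma adjoin_exchange:
  assumes B: "subspace B" and V: "x \<in> carrier V" "y \<in> carrier V"
    and x: "x \<in> adjoin B y" "x \<notin> B"
  shows "y \<in> adjoin B x"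
proof -
  obtain b c where bc: "b \<in> B" "c \<in> carrier F" "x = b \<oplus>\<^bsub>V\<^esub> c \<odot>\<^bsub>V\<^esub> y"
    using x(1) by (rule adjoinE)
  have sub: "subspace (adjoin B x)" using adjoin_subspace B V by blast
  have "c \<odot>\<^bsub>V\<^esub> y \<in> adjoin B x"
    using add_cancel_mem[OF sub, of b "c \<odot>\<^bsub>V\<^esub> y"] subset_adjoin[OF B V(1)] mem_adjoin[OF B V(1)] bc V by auto
  moreover have "c \<noteq> \<zero>" using bc x(2) V subspace_mem[OF B] by auto
  ultimately show ?thesis using smult_cancel_mem[OF sub] bc V by blast
qed

lemma adjoin_Int:
  assumes U: "subspace U" "U \<subseteq> P" and P: "subspace P" and y: "y \<in> carrier V" "y \<notin> P"
  shows "adjoin U y \<inter> P = U"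
proof
  show "U \<subseteq> adjoin U y \<inter> P" using U subset_adjoin y by blast
  show "adjoin U y \<inter> P \<subseteq> U"
  proof
    fix v assume v: "v \<in> adjoin U y \<inter> P"
    then obtain u c where uc: "u \<in> U" "c \<in> carrier F" "v = u \<oplus>\<^bsub>V\<^esub> c \<odot>\<^bsub>V\<^esub> y" by (blast elim: adjoinE)
    then have "c \<odot>\<^bsub>V\<^esub> y \<in> P" using add_cancel_mem[OF P, of u "c \<odot>\<^bsub>V\<^esub> y"] v U y by auto
    then have "c = \<zero>" using smult_cancel_mem[OF P] uc y by blast
    then show "v \<in> U" using uc y subspace_mem[OF U(1)] by simp
  qed
qed

text \<open>
  The complements of the line spanned by \<open>z\<close> in \<open>adjoin W z\<close>. For \<open>z \<notin> W\<close> they are the graphs of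
  the linear maps from \<open>W\<close> to this line, hence as many as there are linear functionals on \<open>W\<close>.
\<close>

definition graphs :: "'v set \<Rightarrow> 'v \<Rightarrow> 'v set set" where
  "graphs W z = {U. subspace U \<and> z \<notin> U \<and> adjoin U z = adjoin W z}"

text \<open>
  Extending a linear map from \<open>B\<close> to \<open>adjoin B x\<close>: its value \<open>a \<odot>\<^bsub>V\<^esub> z\<close> at \<open>x\<close> is free.
\<close>

lemma adjoin_graph:
  assumes B: "subspace B" and V: "x \<in> carrier V" "z \<in> carrier V"
    and x: "x \<notin> B" and z: "z \<notin> adjoin B x" and U: "U \<in> graphs B z" and a: "a \<in> carrier F"
  shows "x \<oplus>\<^bsub>V\<^esub> a \<odot>\<^bsub>V\<^esub> z \<notin> adjoin B z"
    and "adjoin U (x \<oplus>\<^bsub>V\<^esub> a \<odot>\<^bsub>V\<^esub> z) \<in> graphs (adjoin B x) z"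
proof -
  let ?y = "x \<oplus>\<^bsub>V\<^esub> a \<odot>\<^bsub>V\<^esub> z"
  have Us: "subspace U" "z \<notin> U" and P: "adjoin U z = adjoin B z" using U unfolding graphs_def by auto
  have y: "?y \<in> carrier V" using V a by simp
  have sP: "subspace (adjoin B z)" "z \<in> adjoin B z" "B \<subseteq> adjoin B z"
    using adjoin_subspace mem_adjoin subset_adjoin B V by auto
  have comb: "?y = a \<odot>\<^bsub>V\<^esub> z \<oplus>\<^bsub>V\<^esub> x" using V a by (simp add: M.a_comm)
  have "x \<notin> adjoin B z" using adjoin_exchange[OF B V] x z by blast
  then show yP: "?y \<notin> adjoin B z"
    using add_cancel_mem[OF sP(1), of "a \<odot>\<^bsub>V\<^esub> z" x] submoduleE(4)[OF sP(1) a sP(2)] V comb by auto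
  then have "z \<notin> adjoin U ?y" using adjoin_exchange[OF Us(1) V(2) y] Us(2) P by auto
  moreover have sub: "subspace (adjoin U ?y)" "subspace (adjoin B x)" using adjoin_subspace Us B V y by auto
  moreover have "adjoin (adjoin U ?y) z = adjoin (adjoin B x) z" (is "?L = ?R")
  proof
    have sL: "subspace ?L" "z \<in> ?L" "adjoin U ?y \<subseteq> ?L" and sR: "subspace ?R" "z \<in> ?R" "adjoin B x \<subseteq> ?R"
      using adjoin_subspace mem_adjoin subset_adjoin sub V by auto
    have az: "a \<odot>\<^bsub>V\<^esub> z \<in> ?L" "a \<odot>\<^bsub>V\<^esub> z \<in> ?R" using submoduleE(4) sL sR a by auto
    have "U \<subseteq> ?L" "?y \<in> ?L" "B \<subseteq> ?R" "x \<in> ?R"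
      using sL sR subset_adjoin[OF Us(1) y] mem_adjoin[OF Us(1) y] subset_adjoin[OF B V(1)] mem_adjoin[OF B V(1)] by auto
    then have "adjoin B z \<subseteq> ?L" "adjoin B z \<subseteq> ?R" using adjoin_least sL sR P by metis+
    moreover have "x \<in> ?L" using add_cancel_mem[OF sL(1) az(1) V(1)] \<open>?y \<in> ?L\<close> comb by simp
    moreover have "?y \<in> ?R" using submoduleE(5)[OF sR(1) \<open>x \<in> ?R\<close> az(2)] .
    moreover have "U \<subseteq> adjoin B z" using subset_adjoin[OF Us(1) V(2)] P by simp
    ultimately have "U \<subseteq> ?R" "?y \<in> ?R" "B \<subseteq> ?L" "x \<in> ?L"
      using \<open>adjoin B z \<subseteq> ?L\<close> \<open>adjoin B z \<subseteq> ?R\<close> sP(3) by auto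
    then show "?L \<subseteq> ?R" "?R \<subseteq> ?L"
      using sL(1,2) sR(1,2) by (simp_all add: adjoin_least)
  qed
  ultimately show "adjoin U ?y \<in> graphs (adjoin B x) z" unfolding graphs_def by simp
qed

text \<open>
  The dual space has as many elements as the space. In the induction step, the graph over \<open>B\<close> is
  recovered from the extended graph by intersecting with \<open>adjoin B z\<close>, and the value at \<open>x\<close> is unique
  because an extended graph does not contain \<open>z\<close>; so every graph has \<open>card (carrier F)\<close> extensions.
\<close>

lemma card_graphs:
  assumes W: "subspace W" and z: "z \<in> carrier V" "z \<notin> W"
  shows "card W \<le> card (graphs W z)"
proof -
  have fin: "finite (graphs B z)" for B using finite_subspaces unfolding graphs_def by simp
  have "{\<zero>\<^bsub>V\<^esub>} \<subseteq> W" using subspace_zero[OF W] by simp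
  with zero_subspace W show ?thesis
  proof (induction rule: adjoin_chain_induct)
    case base
    have "{\<zero>\<^bsub>V\<^esub>} \<in> graphs {\<zero>\<^bsub>V\<^esub>} z"
      using zero_subspace z subspace_zero[OF W] unfolding graphs_def by auto
    then have "card (graphs {\<zero>\<^bsub>V\<^esub>} z) \<noteq> 0" using fin by auto
    then show ?case by simp
  next
    case (adjoin B x)
    have zB: "z \<notin> adjoin B x" using adjoin_least[OF W adjoin(3,4)] z by blast
    note step = adjoin_graph[OF adjoin(1,5) z(1) adjoin(6) zB]
    let ?f = "\<lambda>(U, a). adjoin U (x \<oplus>\<^bsub>V\<^esub> a \<odot>\<^bsub>V\<^esub> z)"
    have "inj_on ?f (graphs B z \<times> carrier F)"
    proof (rule inj_onI, clarify)
      fix U a U' a' assume U: "U \<in> graphs B z" "U' \<in> graphs B z" and a: "a \<in> carrier F" "a' \<in> carrier F"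
        and eq: "adjoin U (x \<oplus>\<^bsub>V\<^esub> a \<odot>\<^bsub>V\<^esub> z) = adjoin U' (x \<oplus>\<^bsub>V\<^esub> a' \<odot>\<^bsub>V\<^esub> z)"
      have Us': "subspace U" "subspace U'" and Uz: "adjoin U z = adjoin B z" "adjoin U' z = adjoin B z"
        using U unfolding graphs_def by auto
      then have Us: "subspace U" "subspace U'" "U \<subseteq> adjoin B z" "U' \<subseteq> adjoin B z"
        using subset_adjoin[of U z] subset_adjoin[of U' z] z by auto
      have V: "x \<oplus>\<^bsub>V\<^esub> a \<odot>\<^bsub>V\<^esub> z \<in> carrier V" "x \<oplus>\<^bsub>V\<^esub> a' \<odot>\<^bsub>V\<^esub> z \<in> carrier V"
        using adjoin(5) a z by auto
      have "U = U'"
        using adjoin_Int[OF Us(1,3) adjoin_subspace[OF adjoin(1) z(1)] V(1) step(1)[OF U(1) a(1)]]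
          adjoin_Int[OF Us(2,4) adjoin_subspace[OF adjoin(1) z(1)] V(2) step(1)[OF U(2) a(2)]] eq by simp
      let ?T = "adjoin U (x \<oplus>\<^bsub>V\<^esub> a \<odot>\<^bsub>V\<^esub> z)"
      have T: "subspace ?T" "z \<notin> ?T" using step(2)[OF U(1) a(1)] unfolding graphs_def by auto
      have in_T: "x \<oplus>\<^bsub>V\<^esub> a \<odot>\<^bsub>V\<^esub> z \<in> ?T" "x \<oplus>\<^bsub>V\<^esub> a' \<odot>\<^bsub>V\<^esub> z \<in> ?T"
        using mem_adjoin Us V eq by metis+
      have "x \<oplus>\<^bsub>V\<^esub> a' \<odot>\<^bsub>V\<^esub> z \<oplus>\<^bsub>V\<^esub> (a \<ominus> a') \<odot>\<^bsub>V\<^esub> z = x \<oplus>\<^bsub>V\<^esub> (a' \<oplus> (a \<ominus> a')) \<odot>\<^bsub>V\<^esub> z"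
        using adjoin(5) a z by (simp add: smult_l_distr M.a_assoc)
      also have "a' \<oplus> (a \<ominus> a') = a" using a R.r_neg2[of a' a] by (simp add: R.minus_eq R.a_comm[of a "\<ominus> a'"])
      finally have "(a \<ominus> a') \<odot>\<^bsub>V\<^esub> z \<in> ?T"
        using add_cancel_mem[OF T(1) in_T(2), of "(a \<ominus> a') \<odot>\<^bsub>V\<^esub> z"] in_T(1) a z by simp
      then have "a \<ominus> a' = \<zero>" using smult_cancel_mem[OF T(1) _ _ z(1)] T(2) a by (meson R.minus_closed)
      then show "U = U' \<and> a = a'" using a \<open>U = U'\<close> by (simp add: R.r_right_minus_eq)
    qed
    moreover have "?f ` (graphs B z \<times> carrier F) \<subseteq> graphs (adjoin B x) z" using step(2) by auto
    ultimately have "card (graphs B z \<times> carrier F) \<le> card (graphs (adjoin B x) z)"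
      using card_inj_on_le fin by blast
    then have "card (graphs B z) * card (carrier F) \<le> card (graphs (adjoin B x) z)"
      by (simp add: card_cartesian_product)
    moreover have "card B * card (carrier F) \<le> card (graphs B z) * card (carrier F)"
      using adjoin.IH by simp
    ultimately show ?case using card_adjoin[OF adjoin(1,5,6)] by linarith
  qed
qed

lemma card_Grassmannian_ge_dim:
  assumes W: "subspace W" "W \<noteq> carrier V"
  shows "card W \<le> card {U. subspace U \<and> card U = card W}"
proof -
  obtain z where z: "z \<in> carrier V" "z \<notin> W" using W subspace_subset by blast
  have "card U = card W" if "U \<in> graphs W z" for U
    using that card_adjoin[OF W(1) z] card_adjoin[of U z] z card_scalars unfolding graphs_def by auto
  then have "graphs W z \<subseteq> {U. subspace U \<and> card U = card W}" unfolding graphs_def by blast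
  moreover have "finite {U. subspace U \<and> card U = card W}" using finite_subspaces by simp
  ultimately have "card (graphs W z) \<le> card {U. subspace U \<and> card U = card W}" by (rule card_mono[rotated])
  then show ?thesis using card_graphs[OF W(1) z] by simp
qed

text \<open>
  The product of the two lower bounds is free of the dimension of \<open>W\<close>.
\<close>

lemma card_vectors_le_Grassmannian_squared:
  assumes "subspace W" "W \<noteq> {\<zero>\<^bsub>V\<^esub>}" "W \<noteq> carrier V"
  shows "card (carrier V) \<le> (card {U. subspace U \<and> card U = card W})\<^sup>2"
proof -
  let ?N = "card {U. subspace U \<and> card U = card W}"
  have "card (carrier V) \<le> ?N * card W" using card_Grassmannian_ge_codim[OF assms(1,2)] .
  also have "\<dots> \<le> ?N * ?N" by (intro mult_le_mono2 card_Grassmannian_ge_dim assms)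
  finally show ?thesis by (simp add: power2_eq_square)
qed

end

section \<open>Products of finite chains\<close>

lemma finite_total_preorder_least:
  assumes "finite A" "A \<noteq> {}" "\<And>x y. \<lbrakk>x \<in> A; y \<in> A\<rbrakk> \<Longrightarrow> R x y \<or> R y x"
    and "\<And>x y z. \<lbrakk>x \<in> A; y \<in> A; z \<in> A; R x y; R y z\<rbrakk> \<Longrightarrow> R x z"
  shows "\<exists>b\<in>A. \<forall>x\<in>A. R b x"
  using assms
proof (induction rule: finite_ne_induct)
  case (singleton x)
  then show ?case by blast
next
  case (insert a A)
  have "\<exists>b\<in>A. \<forall>x\<in>A. R b x"
    by (rule insert.IH) (use insert.prems in blast)+
  then obtain b where b: "b \<in> A" "\<forall>x\<in>A. R b x" by blast
  show ?case
  proof (cases "R b a")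
    case True
    then show ?thesis using b by blast
  next
    case False
    then have "R a b" using insert.prems(1) b(1) by blast
    then have "\<forall>x\<in>insert a A. R a x" using b insert.prems(1)[of a a] insert.prems(2)[of a b] by auto
    then show ?thesis by blast
  qed
qed

text \<open>
  Meets and joins refer to the order on \<open>L\<close> alone, since an isomorphism of orders says nothing about
  intersections and sums. That they agree with these for lattices of invariant subspaces is
  shown in \<open>fixed_closed_in_invariant_subspaces\<close>.
\<close>

definition bottom_in :: "'b set set \<Rightarrow> 'b set \<Rightarrow> bool" where
  "bottom_in L C \<longleftrightarrow> C \<in> L \<and> (\<forall>D\<in>L. C \<subseteq> D)"

definition meet_in :: "'b set set \<Rightarrow> 'b set \<Rightarrow> 'b set \<Rightarrow> 'b set \<Rightarrow> bool" where
  "meet_in L A B C \<longleftrightarrow> C \<in> L \<and> C \<subseteq> A \<and> C \<subseteq> B \<and> (\<forall>D\<in>L. D \<subseteq> A \<longrightarrow> D \<subseteq> B \<longrightarrow> D \<subseteq> C)"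

definition join_in :: "'b set set \<Rightarrow> 'b set \<Rightarrow> 'b set \<Rightarrow> 'b set \<Rightarrow> bool" where
  "join_in L A B C \<longleftrightarrow> C \<in> L \<and> A \<subseteq> C \<and> B \<subseteq> C \<and> (\<forall>D\<in>L. A \<subseteq> D \<longrightarrow> B \<subseteq> D \<longrightarrow> C \<subseteq> D)"

definition closed_in :: "'b set set \<Rightarrow> 'b set set \<Rightarrow> bool" where
  "closed_in L S \<longleftrightarrow> (\<forall>C. bottom_in L C \<longrightarrow> C \<in> S) \<and>
    (\<forall>A\<in>L \<inter> S. \<forall>B\<in>L \<inter> S. \<forall>C. meet_in L A B C \<or> join_in L A B C \<longrightarrow> C \<in> S)"

text \<open>
  A product of chains indexed by \<open>I\<close> is generated, as a lattice with bottom, by two chains. For an index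
  \<open>i\<close> and an element \<open>c\<close> of the \<open>i\<close>-th factor, let \<open>x i c\<close> have the component \<open>c\<close> at \<open>i\<close>, the top
  at all smaller indices and the bottom at all larger ones, and let \<open>y i c\<close> be defined with the
  reverse order of indices. The elements \<open>x i c\<close> form a chain, and so do the elements \<open>y i c\<close>.
  Their meet \<open>x i c \<sqinter> y i c\<close> has \<open>c\<close> at \<open>i\<close> and the bottom elsewhere, and every element of the
  product is a finite join of such elements.
\<close>

lemma generating_chains:
  assumes "is_product_of_finite_chains (inclusion_order L)"
  shows "\<exists>\<A>\<subseteq>L. \<exists>\<B>\<subseteq>L. (\<forall>A\<in>\<A>. \<forall>B\<in>\<A>. A \<subseteq> B \<or> B \<subseteq> A) \<and> (\<forall>A\<in>\<B>. \<forall>B\<in>\<B>. A \<subseteq> B \<or> B \<subseteq> A) \<and>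
    (\<forall>S. \<A> \<union> \<B> \<subseteq> S \<longrightarrow> closed_in L S \<longrightarrow> L \<subseteq> S)"
proof (cases "L = {}")
  case True
  then show ?thesis by simp
next
  case False
  obtain I :: "nat set" and C :: "nat \<Rightarrow> nat gorder" where
    IC: "finite I \<and> (\<forall>i\<in>I. total_order (C i) \<and> finite (carrier (C i))) \<and>
      order_isomorphic (inclusion_order L) (product_order I C)"
    using assms unfolding is_product_of_finite_chains_def by (elim exE) (rule that)
  then have I: "finite I"
    and C: "\<And>i. i \<in> I \<Longrightarrow> total_order (C i)" "\<And>i. i \<in> I \<Longrightarrow> finite (carrier (C i))"
    and iso: "order_isomorphic (inclusion_order L) (product_order I C)" by auto
  define P where "P = (\<Pi>\<^sub>E i\<in>I. carrier (C i))"
  define leP where "leP p r \<longleftrightarrow> (\<forall>i\<in>I. p i \<sqsubseteq>\<^bsub>C i\<^esub> r i)" for p r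
  obtain f where f: "bij_betw f L P"
      "isotone (inclusion_order L) (product_order I C) f"
      "isotone (product_order I C) (inclusion_order L) (inv_into L f)"
    using iso unfolding order_isomorphic_def
    by (elim exE conjE, intro that) (simp_all add: inclusion_order_def product_order_def P_def)
  define h where "h = inv_into L f"
  have hL: "h p \<in> L" if "p \<in> P" for p
    using that f(1) unfolding h_def by (metis bij_betw_imp_surj_on inv_into_into)
  have fP: "f A \<in> P" if "A \<in> L" for A using that f(1) bij_betwE by blast
  have hf: "h (f A) = A" if "A \<in> L" for A
    using that f(1) unfolding h_def by (simp add: bij_betw_inv_into_left)
  have fh: "f (h p) = p" if "p \<in> P" for p
    using that f(1) unfolding h_def by (simp add: bij_betw_inv_into_right)
  have f_le: "leP (f A) (f B)" if "A \<in> L" "B \<in> L" "A \<subseteq> B" for A B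
    using f(2) that unfolding isotone_def inclusion_order_def product_order_def leP_def by simp
  have h_le: "h p \<subseteq> h r" if "p \<in> P" "r \<in> P" "leP p r" for p r
    using f(3) that unfolding isotone_def inclusion_order_def product_order_def leP_def P_def h_def by simp
  have below_h: "leP (f A) p" if "A \<in> L" "p \<in> P" "A \<subseteq> h p" for A p
    using f_le[OF that(1) hL[OF that(2)] that(3)] fh[OF that(2)] by simp
  have above_h: "leP p (f A)" if "A \<in> L" "p \<in> P" "h p \<subseteq> A" for A p
    using f_le[OF hL[OF that(2)] that(1) that(3)] fh[OF that(2)] by simp
  have nonempty: "carrier (C i) \<noteq> {}" if "i \<in> I" for i
    using False fP that unfolding P_def by (metis PiE_mem all_not_in_conv)
  have le_refl: "x \<sqsubseteq>\<^bsub>C i\<^esub> x" if "i \<in> I" "x \<in> carrier (C i)" for i x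
    using C(1)[OF that(1)] that(2) by (meson total_order_def partial_order_def weak_partial_order.le_refl)
  have le_trans: "x \<sqsubseteq>\<^bsub>C i\<^esub> z"
    if "i \<in> I" "x \<in> carrier (C i)" "y \<in> carrier (C i)" "z \<in> carrier (C i)" "x \<sqsubseteq>\<^bsub>C i\<^esub> y" "y \<sqsubseteq>\<^bsub>C i\<^esub> z" for i x y z
    using C(1)[OF that(1)] that(2-) by (meson total_order_def partial_order_def weak_partial_order.le_trans)
  have le_total: "x \<sqsubseteq>\<^bsub>C i\<^esub> y \<or> y \<sqsubseteq>\<^bsub>C i\<^esub> x" if "i \<in> I" "x \<in> carrier (C i)" "y \<in> carrier (C i)" for i x y
    using C(1)[OF that(1)] that(2-) by (meson total_order.total_order_total)
  have "\<exists>b\<in>carrier (C i). \<forall>x\<in>carrier (C i). b \<sqsubseteq>\<^bsub>C i\<^esub> x" if "i \<in> I" for i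
    using finite_total_preorder_least[OF C(2) nonempty, OF that that, of "le (C i)"] le_total le_trans that by blast
  then obtain bt where bt: "\<And>i. i \<in> I \<Longrightarrow> bt i \<in> carrier (C i)"
    "\<And>i x. i \<in> I \<Longrightarrow> x \<in> carrier (C i) \<Longrightarrow> bt i \<sqsubseteq>\<^bsub>C i\<^esub> x" by metis
  have "\<exists>t\<in>carrier (C i). \<forall>x\<in>carrier (C i). x \<sqsubseteq>\<^bsub>C i\<^esub> t" if "i \<in> I" for i
    using finite_total_preorder_least[OF C(2) nonempty, OF that that, of "\<lambda>x y. y \<sqsubseteq>\<^bsub>C i\<^esub> x"] le_total le_trans that by blast
  then obtain tp where tp: "\<And>i. i \<in> I \<Longrightarrow> tp i \<in> carrier (C i)"
    "\<And>i x. i \<in> I \<Longrightarrow> x \<in> carrier (C i) \<Longrightarrow> x \<sqsubseteq>\<^bsub>C i\<^esub> tp i" by metis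
  define x where "x i c = (\<lambda>j\<in>I. if j < i then tp j else if j = i then c else bt j)" for i c
  define y where "y i c = (\<lambda>j\<in>I. if j < i then bt j else if j = i then c else tp j)" for i c
  \<comment> \<open>\<open>s i c\<close> is the meet of \<open>x i c\<close> and \<open>y i c\<close>; \<open>e J p\<close> is the join of the \<open>s i (p i)\<close> for \<open>i \<in> J\<close>.\<close>
  define s where "s i c = (\<lambda>j\<in>I. if j = i then c else bt j)" for i c
  define e where "e J p = (\<lambda>j\<in>I. if j \<in> J then p j else bt j)" for J p
  have xP: "x i c \<in> P" and yP: "y i c \<in> P" and sP: "s i c \<in> P" if "i \<in> I" "c \<in> carrier (C i)" for i c
    using that bt(1) tp(1) unfolding x_def y_def s_def P_def by auto
  have eP: "e J p \<in> P" if "p \<in> P" for J p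
    using that bt(1) unfolding e_def P_def by auto
  have x_chain: "leP (x i c) (x j d)" if "i \<in> I" "c \<in> carrier (C i)" "j \<in> I" "d \<in> carrier (C j)"
      "i < j \<or> i = j \<and> c \<sqsubseteq>\<^bsub>C i\<^esub> d" for i j c d
    using that bt tp le_refl unfolding x_def leP_def by auto
  have y_chain: "leP (y j d) (y i c)" if "i \<in> I" "c \<in> carrier (C i)" "j \<in> I" "d \<in> carrier (C j)"
      "i < j \<or> i = j \<and> d \<sqsubseteq>\<^bsub>C i\<^esub> c" for i j c d
    using that bt tp le_refl unfolding y_def leP_def by auto
  define \<A> where "\<A> = {h (x i c) | i c. i \<in> I \<and> c \<in> carrier (C i)}"
  define \<B> where "\<B> = {h (y i c) | i c. i \<in> I \<and> c \<in> carrier (C i)}"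
  have sub_L: "\<A> \<subseteq> L" "\<B> \<subseteq> L" using hL xP yP unfolding \<A>_def \<B>_def by auto
  have chain: "\<forall>A\<in>\<C>. \<forall>B\<in>\<C>. A \<subseteq> B \<or> B \<subseteq> A"
    if \<C>: "\<C> = {h (z i c) | i c. i \<in> I \<and> c \<in> carrier (C i)}"
      and zP: "\<And>i c. \<lbrakk>i \<in> I; c \<in> carrier (C i)\<rbrakk> \<Longrightarrow> z i c \<in> P"
      and z: "\<And>i c j d. \<lbrakk>i \<in> I; c \<in> carrier (C i); j \<in> I; d \<in> carrier (C j)\<rbrakk> \<Longrightarrow>
        leP (z i c) (z j d) \<or> leP (z j d) (z i c)" for \<C> z
  proof (intro ballI)
    fix A B assume "A \<in> \<C>" "B \<in> \<C>"
    then obtain i c j d where ic: "i \<in> I" "c \<in> carrier (C i)" "A = h (z i c)"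
      and jd: "j \<in> I" "d \<in> carrier (C j)" "B = h (z j d)" unfolding \<C> by auto
    have "leP (z i c) (z j d) \<or> leP (z j d) (z i c)" using z[OF ic(1,2) jd(1,2)] .
    then show "A \<subseteq> B \<or> B \<subseteq> A" using h_le zP[OF ic(1,2)] zP[OF jd(1,2)] ic(3) jd(3) by auto
  qed
  have chain_\<A>: "\<forall>A\<in>\<A>. \<forall>B\<in>\<A>. A \<subseteq> B \<or> B \<subseteq> A"
  proof (rule chain[OF \<A>_def xP])
    fix i c j d assume *: "i \<in> I" "c \<in> carrier (C i)" "j \<in> I" "d \<in> carrier (C j)"
    show "leP (x i c) (x j d) \<or> leP (x j d) (x i c)"
      using x_chain[OF *] x_chain[OF *(3,4,1,2)] le_total * by (metis linorder_neqE_nat)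
  qed
  have chain_\<B>: "\<forall>A\<in>\<B>. \<forall>B\<in>\<B>. A \<subseteq> B \<or> B \<subseteq> A"
  proof (rule chain[OF \<B>_def yP])
    fix i c j d assume *: "i \<in> I" "c \<in> carrier (C i)" "j \<in> I" "d \<in> carrier (C j)"
    show "leP (y i c) (y j d) \<or> leP (y j d) (y i c)"
      using y_chain[OF *] y_chain[OF *(3,4,1,2)] le_total * by (metis linorder_neqE_nat)
  qed
  have generate: "L \<subseteq> S" if sub: "\<A> \<union> \<B> \<subseteq> S" and "closed_in L S" for S
  proof -
    note closed = \<open>closed_in L S\<close>[unfolded closed_in_def]
    have bottom: "Z \<in> S" if "bottom_in L Z" for Z using closed that by blast
    have meet: "Z \<in> S" if "A \<in> L" "A \<in> S" "B \<in> L" "B \<in> S" "meet_in L A B Z" for A B Z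
      using closed that by blast
    have join: "Z \<in> S" if "A \<in> L" "A \<in> S" "B \<in> L" "B \<in> S" "join_in L A B Z" for A B Z
      using closed that by blast
    have single: "h (s i c) \<in> S" if ic: "i \<in> I" "c \<in> carrier (C i)" for i c
    proof (rule meet)
      show "h (x i c) \<in> L" "h (y i c) \<in> L" using hL xP yP ic by auto
      show "h (x i c) \<in> S" "h (y i c) \<in> S" using sub ic unfolding \<A>_def \<B>_def by auto
      have "leP (s i c) (x i c)" "leP (s i c) (y i c)"
        using ic bt tp le_refl unfolding s_def x_def y_def leP_def by auto
      then have lower: "h (s i c) \<subseteq> h (x i c)" "h (s i c) \<subseteq> h (y i c)" using h_le xP yP sP ic by auto
      have "D \<subseteq> h (s i c)" if D: "D \<in> L" "D \<subseteq> h (x i c)" "D \<subseteq> h (y i c)" for D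
      proof -
        have le: "leP (f D) (x i c)" "leP (f D) (y i c)" using D below_h xP yP ic by auto
        have "leP (f D) (s i c)" unfolding leP_def
        proof
          fix j assume "j \<in> I"
          then have "f D j \<sqsubseteq>\<^bsub>C j\<^esub> x i c j" "f D j \<sqsubseteq>\<^bsub>C j\<^esub> y i c j" using le unfolding leP_def by auto
          then show "f D j \<sqsubseteq>\<^bsub>C j\<^esub> s i c j" using \<open>j \<in> I\<close>
            unfolding x_def y_def s_def by (cases i j rule: linorder_cases) auto
        qed
        then have "h (f D) \<subseteq> h (s i c)" using h_le fP D sP ic by auto
        then show "D \<subseteq> h (s i c)" using hf D by simp
      qed
      then show "meet_in L (h (x i c)) (h (y i c)) (h (s i c))"
        using lower ic by (simp add: meet_in_def hL sP)
    qed
    have part: "h (e J p) \<in> S" if p: "p \<in> P" and J: "finite J" "J \<subseteq> I" for p J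
      using J
    proof (induction J rule: finite_induct)
      case empty
      show ?case
      proof (rule bottom)
        have "h (e {} p) \<subseteq> D" if D: "D \<in> L" for D
        proof -
          have "leP (e {} p) (f D)" using fP[OF D] bt(2) unfolding leP_def e_def P_def by auto
          then have "h (e {} p) \<subseteq> h (f D)" using h_le fP D eP p by blast
          then show ?thesis using hf D by simp
        qed
        then show "bottom_in L (h (e {} p))" using p by (simp add: bottom_in_def hL eP)
      qed
    next
      case (insert i J)
      have pC: "p j \<in> carrier (C j)" if "j \<in> I" for j using p that unfolding P_def by auto
      have i: "i \<in> I" "p i \<in> carrier (C i)" using insert pC by auto
      show ?case
      proof (rule join)
        show "h (e J p) \<in> L" "h (s i (p i)) \<in> L" using hL eP sP i p by auto
        show "h (e J p) \<in> S" "h (s i (p i)) \<in> S" using insert single i by auto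
        have "leP (e J p) (e (insert i J) p)" "leP (s i (p i)) (e (insert i J) p)"
          using i pC bt le_refl unfolding s_def e_def leP_def by auto
        then have upper: "h (e J p) \<subseteq> h (e (insert i J) p)" "h (s i (p i)) \<subseteq> h (e (insert i J) p)"
          using h_le eP sP i p by auto
        have "h (e (insert i J) p) \<subseteq> D" if D: "D \<in> L" "h (e J p) \<subseteq> D" "h (s i (p i)) \<subseteq> D" for D
        proof -
          have le: "leP (e J p) (f D)" "leP (s i (p i)) (f D)" using D above_h eP sP i p by auto
          have "leP (e (insert i J) p) (f D)" unfolding leP_def
          proof
            fix j assume "j \<in> I"
            then have "e J p j \<sqsubseteq>\<^bsub>C j\<^esub> f D j" "s i (p i) j \<sqsubseteq>\<^bsub>C j\<^esub> f D j" using le unfolding leP_def by auto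
            then show "e (insert i J) p j \<sqsubseteq>\<^bsub>C j\<^esub> f D j" using \<open>j \<in> I\<close>
              unfolding e_def s_def by (auto split: if_splits)
          qed
          then have "h (e (insert i J) p) \<subseteq> h (f D)" using h_le fP D eP p by blast
          then show ?thesis using hf D by simp
        qed
        then show "join_in L (h (e J p)) (h (s i (p i))) (h (e (insert i J) p))"
          using upper p by (simp add: join_in_def hL eP)
      qed
    qed
    show ?thesis
    proof
      fix A assume A: "A \<in> L"
      have "e I (f A) = f A" using fP[OF A] unfolding e_def P_def by (auto simp: PiE_def extensional_def)
      then show "A \<in> S" using part[OF fP[OF A] I order_refl] hf[OF A] by simp
    qed
  qed
  show ?thesis
    by (rule exI[of _ \<A>], rule conjI[OF sub_L(1)], rule exI[of _ \<B>],
        intro conjI allI impI sub_L chain_\<A> chain_\<B>) (erule (1) generate)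
qed

section \<open>Counting subgroups for actions on subspaces\<close>

lemma (in group) carrier_if_index_1:
  assumes H: "subgroup H G" and index: "card (rcosets H) = 1"
  shows "H = carrier G"
proof
  show "H \<subseteq> carrier G" using H by (rule subgroup.subset)
  show "carrier G \<subseteq> H"
  proof
    fix g assume g: "g \<in> carrier G"
    obtain R where R: "rcosets H = {R}" using index by (rule card_1_singletonE)
    have "H #> g \<in> rcosets H" "H \<in> rcosets H"
      using g subgroup.subset[OF H] subgroup.subgroup_in_rcosets[OF H group_axioms] by (simp_all add: rcosetsI)
    then have "H #> g = H" using R by simp
    then show "g \<in> H" using rcos_self[OF g H] by simp
  qed
qed

text \<open>
  The actions of \<open>GL F V\<close> and \<open>PGL F V\<close> on subspaces have the same image. All that follows depends
  on the image only and therefore treats both groups at once.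
\<close>

locale subspace_action = finite_vector_space F V + G: group G
  for F :: "('a, 'r) ring_scheme" (structure) and V :: "('a, 'v, 's) module_scheme" (structure)
    and G :: "('g, 'm) monoid_scheme" +
  fixes act :: "'g \<Rightarrow> 'v set \<Rightarrow> 'v set"
  assumes act_is_linear: "c \<in> carrier G \<Longrightarrow> \<exists>g\<in>carrier (GL F V). \<forall>W. subspace W \<longrightarrow> act c W = g ` W"
    and linear_is_act: "g \<in> carrier (GL F V) \<Longrightarrow> \<exists>c\<in>carrier G. \<forall>W. subspace W \<longrightarrow> act c W = g ` W"
    and act_mult: "\<lbrakk>c \<in> carrier G; d \<in> carrier G; subspace W\<rbrakk> \<Longrightarrow> act (c \<otimes>\<^bsub>G\<^esub> d) W = act c (act d W)"
begin

lemma act_subspace: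
  assumes "c \<in> carrier G" "subspace W"
  shows "subspace (act c W)"
  using act_is_linear[OF assms(1)] GL_image_subspace assms(2) by metis

lemma act_card:
  assumes "c \<in> carrier G" "subspace W"
  shows "card (act c W) = card W"
  using act_is_linear[OF assms(1)] GL_image_card assms(2) by metis

lemma act_mono:
  assumes "c \<in> carrier G" "subspace W" "subspace U" "W \<subseteq> U"
  shows "act c W \<subseteq> act c U"
  using act_is_linear[OF assms(1)] assms(2-4) by (metis image_mono)

text \<open>
  Actions preserve cardinality, so one inclusion suffices.
\<close>

lemma act_fixedI:
  assumes "c \<in> carrier G" "subspace W" "W \<subseteq> act c W \<or> act c W \<subseteq> W"
  shows "act c W = W"
  using assms subspace_eqI[of "act c W" W] subspace_eqI[of W "act c W"] act_card act_subspace by auto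

lemma act_one:
  assumes "subspace W"
  shows "act \<one>\<^bsub>G\<^esub> W = W"
proof -
  obtain g where g: "g \<in> carrier (GL F V)" "\<And>W. subspace W \<Longrightarrow> act \<one>\<^bsub>G\<^esub> W = g ` W"
    using act_is_linear[OF G.one_closed] by blast
  have "g ` (g ` W) = g ` W"
    using act_mult[OF G.one_closed G.one_closed assms] g GL_image_subspace assms by simp
  moreover have "inj_on g (carrier V)" using GL_lin_iso[OF g(1)] unfolding lin_iso_def bij_betw_def by blast
  ultimately have "g ` W = W"
    using inj_on_image_eq_iff subspace_subset assms GL_image_subspace[OF g(1) assms] by metis
  then show ?thesis using g(2) assms by simp
qed

lemma act_inv_fixed:
  assumes "c \<in> carrier G" "subspace W" "act c W = W"
  shows "act (inv\<^bsub>G\<^esub> c) W = W"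
  using act_mult[of "inv\<^bsub>G\<^esub> c" c W] assms act_one by simp

lemma act_zero:
  assumes "c \<in> carrier G"
  shows "act c {\<zero>\<^bsub>V\<^esub>} = {\<zero>\<^bsub>V\<^esub>}"
  using act_fixedI[OF assms zero_subspace] subspace_zero[OF act_subspace[OF assms zero_subspace]] by simp

lemma act_carrier:
  assumes "c \<in> carrier G"
  shows "act c (carrier V) = carrier V"
  using act_fixedI[OF assms carrier_is_submodule]
    subspace_subset[OF act_subspace[OF assms carrier_is_submodule]] by simp

lemma act_Int_fixed:
  assumes "c \<in> carrier G" "subspace A" "subspace B" "act c A = A" "act c B = B"
  shows "act c (A \<inter> B) = A \<inter> B"
proof (rule act_fixedI)
  show "A \<inter> B \<subseteq> act c (A \<inter> B) \<or> act c (A \<inter> B) \<subseteq> A \<inter> B"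
    using act_mono[OF assms(1), of "A \<inter> B"] subspace_Int assms by (metis Int_greatest Int_lower1 Int_lower2)
qed (use subspace_Int assms in auto)

text \<open>
  The sum of two subspaces is taken as the least subspace containing both, which matches the
  definition of joins by their order property.
\<close>

lemma act_hull_fixed:
  assumes c: "c \<in> carrier G" and AB: "subspace A" "subspace B" "act c A = A" "act c B = B"
  shows "act c (subspace_hull (A \<union> B)) = subspace_hull (A \<union> B)"
proof (rule act_fixedI[OF c])
  show sub: "subspace (subspace_hull (A \<union> B))" using hull_subspace subspace_subset AB by simp
  have "A \<union> B \<subseteq> act c (subspace_hull (A \<union> B))"
    using act_mono[OF c AB(1) sub] act_mono[OF c AB(2) sub] subset_hull[of "A \<union> B"] AB(3,4) by auto
  then show "subspace_hull (A \<union> B) \<subseteq> act c (subspace_hull (A \<union> B)) \<or>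
      act c (subspace_hull (A \<union> B)) \<subseteq> subspace_hull (A \<union> B)"
    using hull_least[OF act_subspace[OF c sub]] by blast
qed

text \<open>
  For \<open>c\<close> in \<open>H\<close>, intersections and sums of invariant subspaces are again invariant; so they are the
  meets and joins of the lattice. The same argument applied to an arbitrary \<open>c\<close> shows that
  the subspaces fixed by \<open>c\<close> are closed under the operations of this lattice.
\<close>

lemma fixed_closed_in_invariant_subspaces:
  assumes H: "H \<subseteq> carrier G" and c: "c \<in> carrier G"
  shows "closed_in (invariant_subspaces F V act H) {W. act c W = W}"
proof -
  let ?L = "invariant_subspaces F V act H"
  have L: "W \<in> ?L \<longleftrightarrow> subspace W \<and> (\<forall>h\<in>H. act h W = W)" for W
    unfolding invariant_subspaces_def by simp
  have bottom: "act c W = W" if "bottom_in ?L W" for W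
  proof -
    have "{\<zero>\<^bsub>V\<^esub>} \<in> ?L" using L zero_subspace act_zero H by blast
    then have "W \<subseteq> {\<zero>\<^bsub>V\<^esub>}" "subspace W" using that L unfolding bottom_in_def by auto
    then have "W = {\<zero>\<^bsub>V\<^esub>}" using subspace_zero by blast
    then show ?thesis using act_zero[OF c] by simp
  qed
  have meet: "act c W = W"
    if A: "A \<in> ?L" "act c A = A" and B: "B \<in> ?L" "act c B = B" and W: "meet_in ?L A B W" for A B W
  proof -
    have "A \<inter> B \<in> ?L" using A B L subspace_Int act_Int_fixed H by (meson subsetD)
    then have "W = A \<inter> B" using W unfolding meet_in_def by blast
    then show ?thesis using act_Int_fixed[OF c] A B L by simp
  qed
  have join: "act c W = W"
    if A: "A \<in> ?L" "act c A = A" and B: "B \<in> ?L" "act c B = B" and W: "join_in ?L A B W" for A B W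
  proof -
    let ?J = "subspace_hull (A \<union> B)"
    have "?J \<in> ?L" using A B L hull_subspace[of "A \<union> B"] act_hull_fixed subspace_subset H by (meson Un_least subsetD)
    then have "W \<subseteq> ?J" using W subset_hull[of "A \<union> B"] unfolding join_in_def by simp
    moreover have "?J \<subseteq> W" using W L hull_least[of W "A \<union> B"] unfolding join_in_def by simp
    ultimately show ?thesis using act_hull_fixed[OF c] A B L by simp
  qed
  show ?thesis
    unfolding closed_in_def
  proof (intro conjI allI ballI impI)
    fix A B W
    assume A: "A \<in> ?L \<inter> {W. act c W = W}" and B: "B \<in> ?L \<inter> {W. act c W = W}"
      and "meet_in ?L A B W \<or> join_in ?L A B W"
    then have "act c W = W" using meet[of A B W] join[of A B W] by simp metis
    then show "W \<in> {W. act c W = W}" by simp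
  qed (simp add: bottom)
qed

text \<open>
  The heart of the proof. An element that fixes the two generating chains fixes the whole lattice of
  invariant subspaces, and thus lies in \<open>H\<close> because \<open>H\<close> is closed. Counting subgroups becomes
  counting pairs of flags.
\<close>

lemma chain_product_subgroup_flags:
  assumes "H \<in> chain_product_subgroups F V G act"
  obtains \<A> \<B> where "flag \<A>" "flag \<B>" "\<A> \<subseteq> invariant_subspaces F V act H" "\<B> \<subseteq> invariant_subspaces F V act H"
    "H = {c \<in> carrier G. \<forall>W\<in>\<A> \<union> \<B>. act c W = W}"
proof -
  let ?L = "invariant_subspaces F V act H"
  have sub: "subgroup H G" and H: "H = {c \<in> carrier G. \<forall>W\<in>?L. act c W = W}"
    and prod: "is_product_of_finite_chains (inclusion_order ?L)"
    using assms unfolding chain_product_subgroups_def closed_subgroup_def by auto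
  obtain \<A> \<B> where AB: "\<A> \<subseteq> ?L" "\<B> \<subseteq> ?L"
    and chains: "\<forall>A\<in>\<A>. \<forall>B\<in>\<A>. A \<subseteq> B \<or> B \<subseteq> A" "\<forall>A\<in>\<B>. \<forall>B\<in>\<B>. A \<subseteq> B \<or> B \<subseteq> A"
    and gen: "\<forall>S. \<A> \<union> \<B> \<subseteq> S \<longrightarrow> closed_in ?L S \<longrightarrow> ?L \<subseteq> S"
    using generating_chains[OF prod] by (elim exE conjE) (rule that)
  have "flag \<A>" "flag \<B>" using AB chains unfolding flag_def invariant_subspaces_def by auto
  moreover have "c \<in> H" if c: "c \<in> carrier G" "\<forall>W\<in>\<A> \<union> \<B>. act c W = W" for c
  proof -
    have "?L \<subseteq> {W. act c W = W}"
      using c fixed_closed_in_invariant_subspaces[OF subgroup.subset[OF sub] c(1)] by (intro gen[rule_format]) auto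
    then show ?thesis using c(1) by (subst H) auto
  qed
  then have "H = {c \<in> carrier G. \<forall>W\<in>\<A> \<union> \<B>. act c W = W}"
    using AB subgroup.subset[OF sub] unfolding invariant_subspaces_def by auto
  ultimately show thesis using that AB by blast
qed

definition flags_like :: "'v set set \<Rightarrow> 'v set set set" where
  "flags_like \<F> = {\<F>'. flag \<F>' \<and> card ` \<F>' = card ` \<F>}"

lemma finite_flags: "finite {\<F>. flag \<F>}"
  by (rule finite_subset[of _ "Pow {W. subspace W}"]) (auto simp: flag_def finite_subspaces)

text \<open>
  The right coset of \<open>a\<close> determines the image of the flag under the inverse of \<open>a\<close>, as \<open>H\<close> fixes
  the flag, and transitivity makes every flag of the same type such an image.
\<close>

lemma card_flags_like_le_index:
  assumes H: "subgroup H G" and fin: "finite (rcosets\<^bsub>G\<^esub> H)"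
    and \<F>: "flag \<F>" "\<F> \<subseteq> invariant_subspaces F V act H"
  shows "card (flags_like \<F>) \<le> card (rcosets\<^bsub>G\<^esub> H)"
proof -
  \<comment> \<open>The image does not depend on the representative chosen.\<close>
  let ?f = "\<lambda>R. act (inv\<^bsub>G\<^esub> (SOME a. a \<in> R)) ` \<F>"
  have "flags_like \<F> \<subseteq> ?f ` (rcosets\<^bsub>G\<^esub> H)"
  proof
    fix \<F>' assume "\<F>' \<in> flags_like \<F>"
    then have "flag \<F>'" "card ` \<F> = card ` \<F>'" unfolding flags_like_def by auto
    then obtain g where g: "g \<in> carrier (GL F V)" "(`) g ` \<F> = \<F>'"
      using GL_transitive_on_flags \<F>(1) by blast
    obtain c where c: "c \<in> carrier G" "\<And>W. subspace W \<Longrightarrow> act c W = g ` W"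
      using linear_is_act[OF g(1)] by blast
    have image: "act c ` \<F> = \<F>'" using c(2) g(2) \<F>(1) unfolding flag_def by auto
    let ?R = "H #>\<^bsub>G\<^esub> inv\<^bsub>G\<^esub> c"
    have "(SOME a. a \<in> ?R) \<in> ?R" using G.rcos_self[OF G.inv_closed[OF c(1)] H] by (rule someI)
    then obtain h where h: "h \<in> H" "(SOME a. a \<in> ?R) = h \<otimes>\<^bsub>G\<^esub> inv\<^bsub>G\<^esub> c" unfolding r_coset_def by auto
    have hG: "h \<in> carrier G" using h(1) H subgroup.mem_carrier by metis
    have "inv\<^bsub>G\<^esub> (SOME a. a \<in> ?R) = c \<otimes>\<^bsub>G\<^esub> inv\<^bsub>G\<^esub> h" using h(2) hG c(1) by (simp add: G.inv_mult_group)
    moreover have "act (c \<otimes>\<^bsub>G\<^esub> inv\<^bsub>G\<^esub> h) W = act c W" if "W \<in> \<F>" for W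
    proof -
      have W: "subspace W" "act h W = W" using that \<F>(2) h(1) unfolding invariant_subspaces_def by auto
      then show ?thesis using act_mult[of c "inv\<^bsub>G\<^esub> h" W] act_inv_fixed[OF hG] c(1) hG by simp
    qed
    ultimately have "?f ?R = \<F>'" using image by auto
    moreover have "?R \<in> rcosets\<^bsub>G\<^esub> H" using c(1) H by (simp add: G.rcosetsI subgroup.subset)
    ultimately show "\<F>' \<in> ?f ` (rcosets\<^bsub>G\<^esub> H)" by blast
  qed
  then show ?thesis using surj_card_le[OF fin] by blast
qed

text \<open>
  If no nontrivial subspace were invariant under \<open>H\<close>, then \<open>H\<close> would be the whole group because it
  is closed. So \<open>H\<close> fixes some proper nonzero \<open>W\<close>, and the one-member flag \<open>{W}\<close> gives a
  lower bound for the index that is exponential in the dimension.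
\<close>

lemma card_vectors_le_index_squared:
  assumes H: "closed_subgroup F V G act H" "H \<noteq> carrier G" and fin: "finite (rcosets\<^bsub>G\<^esub> H)"
  shows "card (carrier V) \<le> (card (rcosets\<^bsub>G\<^esub> H))\<^sup>2"
proof -
  let ?L = "invariant_subspaces F V act H"
  have sub: "subgroup H G" and H_eq: "H = {c \<in> carrier G. \<forall>W\<in>?L. act c W = W}"
    using H(1) unfolding closed_subgroup_def by auto
  have "\<exists>W\<in>?L. W \<noteq> {\<zero>\<^bsub>V\<^esub>} \<and> W \<noteq> carrier V"
  proof (rule ccontr)
    assume "\<not> ?thesis"
    then have "carrier G \<subseteq> H" by (subst H_eq) (use act_zero act_carrier in auto)
    then show False using H(2) subgroup.subset[OF sub] by simp
  qed
  then obtain W where W: "W \<in> ?L" "subspace W" "W \<noteq> {\<zero>\<^bsub>V\<^esub>}" "W \<noteq> carrier V"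
    unfolding invariant_subspaces_def by blast
  let ?N = "{U. subspace U \<and> card U = card W}"
  have "(\<lambda>U. {U}) ` ?N \<subseteq> flags_like {W}" unfolding flags_like_def flag_def by auto
  moreover have "finite (flags_like {W})" using finite_flags unfolding flags_like_def by simp
  ultimately have "card ?N \<le> card (flags_like {W})"
    using card_inj_on_le[of "\<lambda>U. {U}" ?N "flags_like {W}"] by (simp add: inj_on_def)
  also have "\<dots> \<le> card (rcosets\<^bsub>G\<^esub> H)"
    using card_flags_like_le_index[OF sub fin, of "{W}"] W by (simp add: flag_def)
  finally have "(card ?N)\<^sup>2 \<le> (card (rcosets\<^bsub>G\<^esub> H))\<^sup>2" by (rule power_mono) simp
  then show ?thesis using card_vectors_le_Grassmannian_squared[OF W(2-4)] by (rule order_trans[rotated])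
qed

text \<open>
  The cardinalities of subspaces are among the \<open>n + 1\<close> powers \<open>card (carrier F) ^ k\<close> with \<open>k \<le> n\<close>, so
  there are at most \<open>2 ^ (n + 1)\<close> types, and each type contributes at most \<open>m\<close> flags.
\<close>

lemma card_flags_with_few_like:
  assumes n: "card (carrier V) = card (carrier F) ^ n"
  shows "card {\<F>. flag \<F> \<and> card (flags_like \<F>) \<le> m} \<le> 2 ^ (n + 1) * m"
proof -
  let ?Q = "(\<lambda>k. card (carrier F) ^ k) ` {..n}"
  let ?X = "{\<F>. flag \<F> \<and> card (flags_like \<F>) \<le> m}"
  have "card W \<in> ?Q" if W: "subspace W" for W
  proof -
    obtain k where k: "card W = card (carrier F) ^ k" using card_subspace_power[OF W] by blast
    have "card (carrier F) ^ k \<le> card (carrier F) ^ n"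
      using card_mono[OF finite_vectors subspace_subset[OF W]] k n by simp
    then have "k \<le> n" using card_scalars by (simp add: power_le_imp_le_exp)
    then show ?thesis using k by auto
  qed
  then have "card ` \<F> \<in> Pow ?Q" if "flag \<F>" for \<F> using that unfolding flag_def by blast
  then have "?X \<subseteq> (\<Union>D\<in>Pow ?Q. {\<F> \<in> ?X. card ` \<F> = D})" by blast
  moreover have finX: "finite {\<F> \<in> ?X. card ` \<F> = D}" for D using finite_flags by simp
  ultimately have "card ?X \<le> card (\<Union>D\<in>Pow ?Q. {\<F> \<in> ?X. card ` \<F> = D})"
    by (intro card_mono finite_UN_I) auto
  also have "\<dots> \<le> (\<Sum>D\<in>Pow ?Q. card {\<F> \<in> ?X. card ` \<F> = D})" by (intro card_UN_le) simp
  also have "\<dots> \<le> (\<Sum>D\<in>Pow ?Q. m)"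
  proof (rule sum_mono)
    fix D
    show "card {\<F> \<in> ?X. card ` \<F> = D} \<le> m"
    proof (cases "{\<F> \<in> ?X. card ` \<F> = D} = {}")
      case True
      then show ?thesis by (simp only: card.empty)
    next
      case False
      then obtain \<F> where \<F>: "flag \<F>" "card (flags_like \<F>) \<le> m" "card ` \<F> = D" by blast
      have "card {\<F> \<in> ?X. card ` \<F> = D} \<le> card (flags_like \<F>)"
        using \<F>(3) finite_flags by (intro card_mono) (auto simp: flags_like_def)
      then show ?thesis using \<F>(2) by simp
    qed
  qed
  also have "\<dots> = card (Pow ?Q) * m" by simp
  also have "\<dots> \<le> 2 ^ (n + 1) * m"
    using card_image_le[of "{..n}" "\<lambda>k. card (carrier F) ^ k"] by (simp add: card_Pow del: power_Suc)
  finally show ?thesis .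
qed

lemma count_le_flag_pairs:
  assumes n: "card (carrier V) = card (carrier F) ^ n" and m: "1 \<le> m"
  shows "count_of_index F V G act m \<le> (2 ^ (n + 1) * m)\<^sup>2"
proof -
  let ?X = "{\<F>. flag \<F> \<and> card (flags_like \<F>) \<le> m}"
  let ?S = "{H \<in> chain_product_subgroups F V G act. card (rcosets\<^bsub>G\<^esub> H) = m}"
  have finX: "finite ?X" using finite_flags by simp
  have "?S \<subseteq> (\<lambda>(\<A>, \<B>). {c \<in> carrier G. \<forall>W\<in>\<A> \<union> \<B>. act c W = W}) ` (?X \<times> ?X)"
  proof
    fix H assume H: "H \<in> ?S"
    then have sub: "subgroup H G" unfolding chain_product_subgroups_def closed_subgroup_def by simp
    \<comment> \<open>An infinite set of cosets would have cardinality 0.\<close>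
    have fin: "finite (rcosets\<^bsub>G\<^esub> H)" using H m by (auto intro: card_ge_0_finite)
    have "H \<in> chain_product_subgroups F V G act" using H by simp
    then obtain \<A> \<B> where AB: "flag \<A>" "flag \<B>"
      "\<A> \<subseteq> invariant_subspaces F V act H" "\<B> \<subseteq> invariant_subspaces F V act H"
      "H = {c \<in> carrier G. \<forall>W\<in>\<A> \<union> \<B>. act c W = W}"
      by (rule chain_product_subgroup_flags)
    have "(\<A>, \<B>) \<in> ?X \<times> ?X" using AB(1-4) card_flags_like_le_index[OF sub fin] H by simp
    then show "H \<in> (\<lambda>(\<A>, \<B>). {c \<in> carrier G. \<forall>W\<in>\<A> \<union> \<B>. act c W = W}) ` (?X \<times> ?X)"
      by (rule image_eqI[rotated]) (simp only: AB(5) prod.case)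
  qed
  then have "card ?S \<le> card (?X \<times> ?X)" using finX by (intro surj_card_le) simp_all
  also have "\<dots> = (card ?X)\<^sup>2" by (simp add: card_cartesian_product power2_eq_square)
  also have "\<dots> \<le> (2 ^ (n + 1) * m)\<^sup>2" by (intro power_mono card_flags_with_few_like n) simp
  finally show ?thesis unfolding count_of_index_def .
qed

text \<open>
  The factor \<open>2 ^ (n + 1)\<close> in the count of flags is polynomial in the index: as soon as some
  \<open>H \<noteq> carrier G\<close> has index \<open>m\<close>, we have \<open>2 ^ n \<le> m\<^sup>2\<close> and \<open>2 \<le> m\<close>, hence \<open>2 ^ (n + 1) \<le> m ^ 3\<close>.
  Otherwise the whole group is the only subgroup that is counted.
\<close>

lemma count_of_index_bound:
  assumes n: "card (carrier V) = card (carrier F) ^ n" and m: "1 \<le> m"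
  shows "count_of_index F V G act m \<le> m ^ 8"
proof -
  let ?S = "{H \<in> chain_product_subgroups F V G act. card (rcosets\<^bsub>G\<^esub> H) = m}"
  show ?thesis
  proof (cases "?S \<subseteq> {carrier G}")
    case True
    then have "card ?S \<le> card {carrier G}" by (intro card_mono) auto
    also have "\<dots> \<le> m ^ 8" using m by simp
    finally show ?thesis unfolding count_of_index_def .
  next
    case False
    then obtain H where H: "closed_subgroup F V G act H" "H \<noteq> carrier G" "card (rcosets\<^bsub>G\<^esub> H) = m"
      unfolding chain_product_subgroups_def by auto
    have "m \<noteq> 1" using G.carrier_if_index_1[of H] H unfolding closed_subgroup_def by auto
    then have m2: "2 \<le> m" using m by simp
    have "finite (rcosets\<^bsub>G\<^esub> H)" using H(3) m by (auto intro: card_ge_0_finite)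
    then have "card (carrier F) ^ n \<le> m\<^sup>2" using card_vectors_le_index_squared[OF H(1,2)] H(3) n by simp
    moreover have "2 ^ n \<le> card (carrier F) ^ n" using card_scalars by (intro power_mono) auto
    ultimately have "2 ^ n \<le> m\<^sup>2" by linarith
    then have "2 ^ (n + 1) \<le> m * m\<^sup>2" using m2 by (simp add: mult_le_mono)
    then have "2 ^ (n + 1) * m \<le> m * m\<^sup>2 * m" by (rule mult_le_mono1)
    then have "(2 ^ (n + 1) * m)\<^sup>2 \<le> (m * m\<^sup>2 * m)\<^sup>2" by (intro power_mono) auto
    also have "(m * m\<^sup>2 * m)\<^sup>2 = m ^ 8" by (simp add: eval_nat_numeral mult_ac)
    finally show ?thesis using count_le_flag_pairs[OF n m] by linarith
  qed
qed

end

section \<open>The linear and the projective linear group\<close>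

lemma (in group) center_normal: "center G \<lhd> G"
  unfolding normal_inv_iff
proof
  show "subgroup (center G) G"
  proof (rule subgroupI)
    show "center G \<subseteq> carrier G" unfolding center_def by blast
    show "center G \<noteq> {}" unfolding center_def by force
    fix a assume a: "a \<in> center G"
    then have aG: "a \<in> carrier G" and comm: "\<And>g. g \<in> carrier G \<Longrightarrow> a \<otimes> g = g \<otimes> a"
      unfolding center_def by auto
    have "inv a \<otimes> g = g \<otimes> inv a" if g: "g \<in> carrier G" for g
    proof -
      have "inv a \<otimes> g = inv a \<otimes> (g \<otimes> a) \<otimes> inv a" using aG g by (simp add: m_assoc)
      also have "\<dots> = inv a \<otimes> (a \<otimes> g) \<otimes> inv a" using comm[OF g] by simp
      also have "\<dots> = g \<otimes> inv a" using aG g by (simp add: m_assoc[symmetric])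
      finally show ?thesis .
    qed
    then show "inv a \<in> center G" using aG unfolding center_def by simp
    fix b assume b: "b \<in> center G"
    then have bG: "b \<in> carrier G" and comm': "\<And>g. g \<in> carrier G \<Longrightarrow> b \<otimes> g = g \<otimes> b"
      unfolding center_def by auto
    have "a \<otimes> b \<otimes> g = g \<otimes> (a \<otimes> b)" if g: "g \<in> carrier G" for g
    proof -
      have "a \<otimes> b \<otimes> g = a \<otimes> (g \<otimes> b)" using aG bG g comm'[OF g] by (simp add: m_assoc)
      also have "\<dots> = g \<otimes> a \<otimes> b" using aG bG g comm[OF g] by (simp add: m_assoc[symmetric])
      finally show ?thesis using aG bG g by (simp add: m_assoc)
    qed
    then show "a \<otimes> b \<in> center G" using aG bG unfolding center_def by simp
  qed
  show "\<forall>x\<in>carrier G. \<forall>h\<in>center G. x \<otimes> h \<otimes> inv x \<in> center G"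
  proof (intro ballI)
    fix x h assume x: "x \<in> carrier G" and h: "h \<in> center G"
    then have hG: "h \<in> carrier G" and "x \<otimes> h = h \<otimes> x" unfolding center_def by auto
    then have "x \<otimes> h \<otimes> inv x = h" using x by (simp add: m_assoc)
    then show "x \<otimes> h \<otimes> inv x \<in> center G" using h by simp
  qed
qed

context finite_vector_space
begin

lemma carrier_GL: "carrier (GL F V) = linear_maps F V \<inter> Bij (carrier V)"
  unfolding GL_def by simp

lemma mult_GL:
  assumes "g \<in> carrier (GL F V)" "h \<in> carrier (GL F V)"
  shows "g \<otimes>\<^bsub>GL F V\<^esub> h = compose (carrier V) g h"
proof -
  have "g \<in> Bij (carrier V)" "h \<in> Bij (carrier V)" using assms unfolding carrier_GL by auto
  then show ?thesis unfolding GL_def BijGroup_def by simp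
qed

lemma group_GL: "group (GL F V)"
proof -
  interpret B: group "BijGroup (carrier V)" by (rule group_BijGroup)
  have "subgroup (linear_maps F V \<inter> Bij (carrier V)) (BijGroup (carrier V))"
  proof (rule B.subgroupI)
    show "linear_maps F V \<inter> Bij (carrier V) \<subseteq> carrier (BijGroup (carrier V))"
      unfolding BijGroup_def by simp
    have "(\<lambda>v\<in>carrier V. v) \<in> linear_maps F V \<inter> Bij (carrier V)"
      using id_Bij unfolding linear_maps_def by auto
    then show "linear_maps F V \<inter> Bij (carrier V) \<noteq> {}" by blast
    fix g assume "g \<in> linear_maps F V \<inter> Bij (carrier V)"
    then have B: "g \<in> Bij (carrier V)" and gV: "\<And>v. v \<in> carrier V \<Longrightarrow> g v \<in> carrier V"
      and add: "\<And>u v. u \<in> carrier V \<Longrightarrow> v \<in> carrier V \<Longrightarrow> g (u \<oplus>\<^bsub>V\<^esub> v) = g u \<oplus>\<^bsub>V\<^esub> g v"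
      and sm: "\<And>c v. c \<in> carrier F \<Longrightarrow> v \<in> carrier V \<Longrightarrow> g (c \<odot>\<^bsub>V\<^esub> v) = c \<odot>\<^bsub>V\<^esub> g v"
      unfolding linear_maps_def by auto
    have bij: "bij_betw g (carrier V) (carrier V)" using B unfolding Bij_def by simp
    let ?i = "\<lambda>v\<in>carrier V. inv_into (carrier V) g v"
    have iV: "inv_into (carrier V) g v \<in> carrier V" if "v \<in> carrier V" for v
      using Bij_inv_into_mem[OF B that] .
    have gi: "g (inv_into (carrier V) g v) = v" if "v \<in> carrier V" for v
      using bij that by (simp add: bij_betw_inv_into_right)
    have ig: "inv_into (carrier V) g (g v) = v" if "v \<in> carrier V" for v
      using bij that by (simp add: bij_betw_inv_into_left)
    have "?i \<in> linear_maps F V" unfolding linear_maps_def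
    proof (intro CollectI conjI ballI)
      show "?i \<in> carrier V \<rightarrow> carrier V" using iV by simp
      fix u v assume uv: "u \<in> carrier V" "v \<in> carrier V"
      have "inv_into (carrier V) g (g (inv_into (carrier V) g u \<oplus>\<^bsub>V\<^esub> inv_into (carrier V) g v)) =
          inv_into (carrier V) g u \<oplus>\<^bsub>V\<^esub> inv_into (carrier V) g v"
        using iV uv by (intro ig) simp
      then show "?i (u \<oplus>\<^bsub>V\<^esub> v) = ?i u \<oplus>\<^bsub>V\<^esub> ?i v" using uv iV by (simp add: add gi)
    next
      fix c v assume cv: "c \<in> carrier F" "v \<in> carrier V"
      have "inv_into (carrier V) g (g (c \<odot>\<^bsub>V\<^esub> inv_into (carrier V) g v)) = c \<odot>\<^bsub>V\<^esub> inv_into (carrier V) g v"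
        using iV cv by (intro ig) simp
      then show "?i (c \<odot>\<^bsub>V\<^esub> v) = c \<odot>\<^bsub>V\<^esub> ?i v" using cv iV by (simp add: sm gi)
    qed
    then show "inv\<^bsub>BijGroup (carrier V)\<^esub> g \<in> linear_maps F V \<inter> Bij (carrier V)"
      using inv_BijGroup[OF B] restrict_inv_into_Bij[OF B] by simp
    fix h assume h: "h \<in> linear_maps F V \<inter> Bij (carrier V)"
    then have "compose (carrier V) g h \<in> linear_maps F V"
      using gV add sm unfolding linear_maps_def by (auto simp: compose_def Pi_iff)
    then show "g \<otimes>\<^bsub>BijGroup (carrier V)\<^esub> h \<in> linear_maps F V \<inter> Bij (carrier V)"
      using B h compose_Bij[OF B, of h] unfolding BijGroup_def by simp
  qed
  then show ?thesis unfolding GL_def by (rule subgroup.subgroup_is_group) (rule group_BijGroup)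
qed

lemma mult_GL_image:
  assumes "g \<in> carrier (GL F V)" "h \<in> carrier (GL F V)" "subspace W"
  shows "(g \<otimes>\<^bsub>GL F V\<^esub> h) ` W = g ` h ` W"
proof -
  have "(g \<otimes>\<^bsub>GL F V\<^esub> h) ` W = (\<lambda>v. g (h v)) ` W"
    using subspace_mem[OF assms(3)] by (intro image_cong) (simp_all add: mult_GL[OF assms(1,2)] compose_def)
  then show ?thesis by (simp add: image_image)
qed

lemma GL_action: "subspace_action F V (GL F V) GL_act"
  by (intro subspace_action.intro subspace_action_axioms.intro finite_vector_space_axioms group_GL)
    (auto simp: GL_act_def mult_GL_image)

text \<open>
  Central elements are homotheties, of which only the following consequence matters. If \<open>z v\<close> were not
  a multiple of \<open>v\<close>, some \<open>g\<close> in \<open>GL F V\<close> would fix \<open>v\<close> and send \<open>z v\<close> to \<open>v \<oplus>\<^bsub>V\<^esub> z v\<close>, and would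
  not commute with \<open>z\<close>.
\<close>

lemma center_GL_image:
  assumes z: "z \<in> center (GL F V)" and W: "subspace W"
  shows "z ` W = W"
proof -
  have zG: "z \<in> carrier (GL F V)"
    and comm: "\<And>g. g \<in> carrier (GL F V) \<Longrightarrow> z \<otimes>\<^bsub>GL F V\<^esub> g = g \<otimes>\<^bsub>GL F V\<^esub> z"
    using z unfolding center_def by auto
  have "z v \<in> W" if v: "v \<in> W" for v
  proof (cases "z v \<in> adjoin {\<zero>\<^bsub>V\<^esub>} v")
    case True
    then show ?thesis using adjoin_least[OF W _ v] subspace_zero[OF W] by blast
  next
    case False
    let ?A = "adjoin {\<zero>\<^bsub>V\<^esub>} v" and ?x = "z v"
    have vV: "v \<in> carrier V" using subspace_mem[OF W v] .
    have xV: "?x \<in> carrier V" using vV GL_lin_iso[OF zG] bij_betwE unfolding lin_iso_def by blast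
    have A: "subspace ?A" "v \<in> ?A" using adjoin_subspace[OF zero_subspace vV] mem_adjoin[OF zero_subspace vV] .
    have xv: "v \<oplus>\<^bsub>V\<^esub> ?x \<notin> ?A" using add_cancel_mem[OF A xV] False by blast
    obtain \<psi> where \<psi>: "lin_iso \<psi> (adjoin ?A ?x) (adjoin ?A (v \<oplus>\<^bsub>V\<^esub> ?x))"
        "\<And>a. a \<in> ?A \<Longrightarrow> \<psi> a = a" "\<psi> ?x = v \<oplus>\<^bsub>V\<^esub> ?x"
      using lin_iso_adjoin[OF A(1) xV False A(1) M.a_closed[OF vV xV] xv lin_iso_id] by blast
    obtain g where g: "g \<in> carrier (GL F V)" "\<And>a. a \<in> adjoin ?A ?x \<Longrightarrow> g a = \<psi> a"
      using lin_iso_extend_GL[OF _ _ \<psi>(1)] adjoin_subspace[OF A(1)] xV vV by blast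
    have "v \<in> adjoin ?A ?x" "?x \<in> adjoin ?A ?x"
      using subset_adjoin[OF A(1) xV] mem_adjoin[OF A(1) xV] A(2) by auto
    then have "g v = v" "g ?x = v \<oplus>\<^bsub>V\<^esub> ?x" using g(2) \<psi>(2,3) A(2) by auto
    moreover have "compose (carrier V) z g = compose (carrier V) g z"
      using comm[OF g(1)] unfolding mult_GL[OF zG g(1)] mult_GL[OF g(1) zG] .
    then have "z (g v) = g ?x" using compose_eq[OF vV] by metis
    ultimately have "v \<oplus>\<^bsub>V\<^esub> ?x = ?x" by metis
    then have "v = \<zero>\<^bsub>V\<^esub>"
      using adjoin_unique[OF A(1) xV False A(2) subspace_zero[OF A(1)] R.one_closed R.one_closed] vV xV by simp
    moreover have "z (\<zero> \<odot>\<^bsub>V\<^esub> v) = \<zero> \<odot>\<^bsub>V\<^esub> ?x"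
      using GL_lin_iso[OF zG] vV unfolding lin_iso_def by blast
    ultimately have "?x = \<zero>\<^bsub>V\<^esub>" using vV xV by simp
    then show ?thesis using False subspace_zero[OF A(1)] by simp
  qed
  then have "z ` W \<subseteq> W" by (rule image_subsetI)
  then show ?thesis using GL_image_card[OF zG W] by (rule subspace_eqI[OF W])
qed

lemma PGL_act_coset:
  assumes g: "g \<in> carrier (GL F V)" and W: "subspace W"
  shows "PGL_act (center (GL F V) #>\<^bsub>GL F V\<^esub> g) W = g ` W"
proof -
  interpret G: group "GL F V" by (rule group_GL)
  have "GL_act h W = g ` W" if "h \<in> center (GL F V) #>\<^bsub>GL F V\<^esub> g" for h
  proof -
    obtain z where z: "z \<in> center (GL F V)" "h = z \<otimes>\<^bsub>GL F V\<^esub> g"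
      using \<open>h \<in> center (GL F V) #>\<^bsub>GL F V\<^esub> g\<close> unfolding r_coset_def by blast
    then have "z \<in> carrier (GL F V)" unfolding center_def by blast
    then show ?thesis
      using mult_GL_image[OF _ g W] center_GL_image[OF z(1) GL_image_subspace[OF g W]] z(2)
      unfolding GL_act_def by simp
  qed
  moreover have "g \<in> center (GL F V) #>\<^bsub>GL F V\<^esub> g"
    using G.rcos_self[OF g normal_imp_subgroup[OF G.center_normal]] .
  ultimately show ?thesis unfolding PGL_act_def by blast
qed

lemma PGL_action: "subspace_action F V (PGL F V) PGL_act"
proof -
  interpret G: group "GL F V" by (rule group_GL)
  interpret N: normal "center (GL F V)" "GL F V" by (rule G.center_normal)
  have carrier: "carrier (PGL F V) = (\<lambda>g. center (GL F V) #>\<^bsub>GL F V\<^esub> g) ` carrier (GL F V)"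
    unfolding PGL_def by (rule carrier_FactGroup)
  show ?thesis
  proof (intro subspace_action.intro subspace_action_axioms.intro finite_vector_space_axioms)
    show "group (PGL F V)" unfolding PGL_def by (rule N.factorgroup_is_group)
    show "\<exists>g\<in>carrier (GL F V). \<forall>W. subspace W \<longrightarrow> PGL_act c W = g ` W" if "c \<in> carrier (PGL F V)" for c
      using that PGL_act_coset unfolding carrier by blast
    show "\<exists>c\<in>carrier (PGL F V). \<forall>W. subspace W \<longrightarrow> PGL_act c W = g ` W" if "g \<in> carrier (GL F V)" for g
      using that PGL_act_coset unfolding carrier by blast
    fix c d W assume "c \<in> carrier (PGL F V)" "d \<in> carrier (PGL F V)" and W: "subspace W"
    then obtain g h where g: "g \<in> carrier (GL F V)" "c = center (GL F V) #>\<^bsub>GL F V\<^esub> g"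
      and h: "h \<in> carrier (GL F V)" "d = center (GL F V) #>\<^bsub>GL F V\<^esub> h" unfolding carrier by blast
    have "c \<otimes>\<^bsub>PGL F V\<^esub> d = center (GL F V) #>\<^bsub>GL F V\<^esub> (g \<otimes>\<^bsub>GL F V\<^esub> h)"
      using g h N.rcos_sum unfolding PGL_def by simp
    then show "PGL_act (c \<otimes>\<^bsub>PGL F V\<^esub> d) W = PGL_act c (PGL_act d W)"
      using g h W by (simp add: PGL_act_coset mult_GL_image GL_image_subspace)
  qed
qed

end

section \<open>Coordinate spaces\<close>

lemma module_coord_space:
  assumes "field F"
  shows "module F (coord_space F n)"
proof -
  interpret F: field F by (rule assms)
  have carrier: "carrier (coord_space F n) = {..<n} \<rightarrow>\<^sub>E carrier F"
    and add: "\<And>u v. u \<oplus>\<^bsub>coord_space F n\<^esub> v = (\<lambda>i\<in>{..<n}. u i \<oplus>\<^bsub>F\<^esub> v i)"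
    and zero: "\<zero>\<^bsub>coord_space F n\<^esub> = (\<lambda>i\<in>{..<n}. \<zero>\<^bsub>F\<^esub>)"
    and smult: "\<And>a v. a \<odot>\<^bsub>coord_space F n\<^esub> v = (\<lambda>i\<in>{..<n}. a \<otimes>\<^bsub>F\<^esub> v i)"
    unfolding coord_space_def by simp_all
  have mem: "v i \<in> carrier F" if "v \<in> {..<n} \<rightarrow>\<^sub>E carrier F" "i < n" for v i
    using that by (auto simp: PiE_iff)
  have ext: "(\<lambda>i\<in>{..<n}. v i) = v" if "v \<in> {..<n} \<rightarrow>\<^sub>E carrier F" for v
    using that by (simp add: PiE_iff extensional_restrict)
  have "abelian_group (coord_space F n)"
  proof (rule abelian_groupI)
    fix u v w
    assume u: "u \<in> carrier (coord_space F n)" and v: "v \<in> carrier (coord_space F n)"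
    show "u \<oplus>\<^bsub>coord_space F n\<^esub> v \<in> carrier (coord_space F n)"
      using u v mem unfolding carrier add by auto
    show "u \<oplus>\<^bsub>coord_space F n\<^esub> v = v \<oplus>\<^bsub>coord_space F n\<^esub> u"
      using u v mem unfolding carrier add by (intro restrict_ext) (simp add: F.a_comm)
    assume w: "w \<in> carrier (coord_space F n)"
    show "u \<oplus>\<^bsub>coord_space F n\<^esub> v \<oplus>\<^bsub>coord_space F n\<^esub> w = u \<oplus>\<^bsub>coord_space F n\<^esub> (v \<oplus>\<^bsub>coord_space F n\<^esub> w)"
      using u v w mem unfolding carrier add by (intro restrict_ext) (simp add: F.a_assoc)
  next
    show "\<zero>\<^bsub>coord_space F n\<^esub> \<in> carrier (coord_space F n)" unfolding carrier zero by simp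
  next
    fix u assume u: "u \<in> carrier (coord_space F n)"
    have "(\<lambda>i\<in>{..<n}. (\<lambda>i\<in>{..<n}. \<zero>\<^bsub>F\<^esub>) i \<oplus>\<^bsub>F\<^esub> u i) = (\<lambda>i\<in>{..<n}. u i)"
      using u mem unfolding carrier by (intro restrict_ext) simp
    then show "\<zero>\<^bsub>coord_space F n\<^esub> \<oplus>\<^bsub>coord_space F n\<^esub> u = u"
      using u ext unfolding carrier add zero by simp
    have "(\<lambda>i\<in>{..<n}. (\<lambda>i\<in>{..<n}. \<ominus>\<^bsub>F\<^esub> u i) i \<oplus>\<^bsub>F\<^esub> u i) = (\<lambda>i\<in>{..<n}. \<zero>\<^bsub>F\<^esub>)"
      using u mem unfolding carrier by (intro restrict_ext) (simp add: F.l_neg)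
    moreover have "(\<lambda>i\<in>{..<n}. \<ominus>\<^bsub>F\<^esub> u i) \<in> carrier (coord_space F n)"
      using u mem unfolding carrier by auto
    ultimately show "\<exists>v\<in>carrier (coord_space F n). v \<oplus>\<^bsub>coord_space F n\<^esub> u = \<zero>\<^bsub>coord_space F n\<^esub>"
      unfolding add zero by blast
  qed
  then show ?thesis
  proof (rule moduleI[OF F.is_cring], unfold carrier add smult)
    fix a u assume a: "a \<in> carrier F" and u: "u \<in> {..<n} \<rightarrow>\<^sub>E carrier F"
    show "(\<lambda>i\<in>{..<n}. a \<otimes>\<^bsub>F\<^esub> u i) \<in> {..<n} \<rightarrow>\<^sub>E carrier F" using a u mem by auto
    fix b assume b: "b \<in> carrier F"
    show "(\<lambda>i\<in>{..<n}. (a \<oplus>\<^bsub>F\<^esub> b) \<otimes>\<^bsub>F\<^esub> u i) =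
        (\<lambda>i\<in>{..<n}. (\<lambda>i\<in>{..<n}. a \<otimes>\<^bsub>F\<^esub> u i) i \<oplus>\<^bsub>F\<^esub> (\<lambda>i\<in>{..<n}. b \<otimes>\<^bsub>F\<^esub> u i) i)"
      using a b u mem by (intro restrict_ext) (simp add: F.l_distr)
    show "(\<lambda>i\<in>{..<n}. a \<otimes>\<^bsub>F\<^esub> b \<otimes>\<^bsub>F\<^esub> u i) = (\<lambda>i\<in>{..<n}. a \<otimes>\<^bsub>F\<^esub> (\<lambda>i\<in>{..<n}. b \<otimes>\<^bsub>F\<^esub> u i) i)"
      using a b u mem by (intro restrict_ext) (simp add: F.m_assoc)
  next
    fix a u v assume a: "a \<in> carrier F" and u: "u \<in> {..<n} \<rightarrow>\<^sub>E carrier F" and v: "v \<in> {..<n} \<rightarrow>\<^sub>E carrier F"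
    show "(\<lambda>i\<in>{..<n}. a \<otimes>\<^bsub>F\<^esub> (\<lambda>i\<in>{..<n}. u i \<oplus>\<^bsub>F\<^esub> v i) i) =
        (\<lambda>i\<in>{..<n}. (\<lambda>i\<in>{..<n}. a \<otimes>\<^bsub>F\<^esub> u i) i \<oplus>\<^bsub>F\<^esub> (\<lambda>i\<in>{..<n}. a \<otimes>\<^bsub>F\<^esub> v i) i)"
      using a u v mem by (intro restrict_ext) (simp add: F.r_distr)
  next
    fix u assume u: "u \<in> {..<n} \<rightarrow>\<^sub>E carrier F"
    have "(\<lambda>i\<in>{..<n}. \<one>\<^bsub>F\<^esub> \<otimes>\<^bsub>F\<^esub> u i) = (\<lambda>i\<in>{..<n}. u i)"
      using u mem by (intro restrict_ext) simp
    then show "(\<lambda>i\<in>{..<n}. \<one>\<^bsub>F\<^esub> \<otimes>\<^bsub>F\<^esub> u i) = u" using ext[OF u] by simp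
  qed
qed

lemma finite_vector_space_coord_space:
  assumes "field F" "finite (carrier F)"
  shows "finite_vector_space F (coord_space F n)"
    and "card (carrier (coord_space F n)) = card (carrier F) ^ n"
proof -
  have carrier: "carrier (coord_space F n) = {..<n} \<rightarrow>\<^sub>E carrier F" unfolding coord_space_def by simp
  show "finite_vector_space F (coord_space F n)"
    using assms module_coord_space[OF assms(1)] carrier
    by (intro finite_vector_space.intro finite_vector_space_axioms.intro) (simp_all add: finite_PiE)
  show "card (carrier (coord_space F n)) = card (carrier F) ^ n"
    unfolding carrier by (simp add: card_PiE)
qed

theorem theorem1p2:
  shows "\<exists>\<alpha>::real. \<forall>(F :: nat ring) (n::nat) (m::nat).
    field F \<longrightarrow> finite (carrier F) \<longrightarrow> m \<ge> 1 \<longrightarrow>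
      (let V = coord_space F n in
        real (count_of_index F V (GL F V) GL_act m) \<le> real m powr \<alpha> \<and>
        real (count_of_index F V (PGL F V) PGL_act m) \<le> real m powr \<alpha>)"
proof (intro exI[of _ 8] allI impI)
  fix F :: "nat ring" and n m :: nat
  assume F: "field F" "finite (carrier F)" and m: "m \<ge> 1"
  let ?V = "coord_space F n"
  interpret finite_vector_space F ?V by (rule finite_vector_space_coord_space[OF F])
  have card: "card (carrier ?V) = card (carrier F) ^ n" by (rule finite_vector_space_coord_space(2)[OF F])
  have powr: "real k \<le> real m powr 8" if "k \<le> m ^ 8" for k
  proof -
    have "real k \<le> real (m ^ 8)" using that by (simp only: of_nat_le_iff)
    also have "\<dots> = real m powr 8" using m by (simp add: powr_numeral)
    finally show ?thesis .
  qed
  have "real (count_of_index F ?V (GL F ?V) GL_act m) \<le> real m powr 8"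
    using subspace_action.count_of_index_bound[OF GL_action card m] by (rule powr)
  moreover have "real (count_of_index F ?V (PGL F ?V) PGL_act m) \<le> real m powr 8"
    using subspace_action.count_of_index_bound[OF PGL_action card m] by (rule powr)
  ultimately show "let V = coord_space F n in
      real (count_of_index F V (GL F V) GL_act m) \<le> real m powr 8 \<and>
      real (count_of_index F V (PGL F V) PGL_act m) \<le> real m powr 8"
    by (simp add: Let_def)
qed

end
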